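(* Let $n\ge 1$ and let $X_{\tau_n}\subset SL_{2n}/P$ be the Schubert variety of $\tau_n\in\mathfrak S_{2n}$, with its natural action of the torus $T_{2n-1}$. The explicit map $\mathbf b$ from the set $\mathrm{DC}_n$ of Dellac configurations (with $2n$ columns and $n$ rows) to $X_{\tau_n}^{T_{2n-1}}$, sending $C$ to the torus fixed point $\sigma_C P$, where $\sigma_C\in\mathfrak S_{2n}$ is the permutation defined by $$\{\sigma_C(2k-1)<\sigma_C(2k)\}=\{\,j : \text{the cell }(k,j)\text{ is marked in }C\,\}\qquad(1\le k\le n),$$ is a well-defined bijection. Hence the number of torus fixed points $\#X_{\tau_n}^{T_{2n-1}}$ is equal to the normalized median Genocchi number $h_n$.
   Context: $\mathfrak S_{2n}$ is generated by $s_i=(i,i+1)$, $1\le i\le 2n-1$. The element $\tau_n=(s_ns_{n+1}\cdots s_{2n-2})\cdots(s_ks_{k+1}\cdots s_{2k-2})\cdots(s_3s_4)s_2$ is the permutation with $\tau_n(2k-1)=k$ and $\tau_n(2k)=n+k$ for $1\le k\le n$. $P\subset SL_{2n}$ is the standard parabolic subgroup (containing the upper triangular Borel subgroup $B$) whose Weyl group is $W_J$, generated by $J=\{s_1,s_3,\dots,s_{2n-1}\}$; so $SL_{2n}/P$ is the variety of partial flags in $\mathbb C^{2n}$ of dimensions $2,4,\dots,2n-2$. $X_{\tau_n}=\overline{B\tau_nP/P}$. $T_{2n-1}$ is the diagonal maximal torus of $SL_{2n}$, and $X_{\tau_n}^{T_{2n-1}}$ is its set of fixed points in $X_{\tau_n}$.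 For $\sigma\in\mathfrak S_{2n}$, the point $\sigma P$ is the coordinate flag whose $2i$-dimensional member is $\langle e_{\sigma(1)},\dots,e_{\sigma(2i)}\rangle$, where $e_1,\dots,e_{2n}$ is the standard basis. A Dellac configuration in $\mathrm{DC}_n$ is a board with $2n$ columns and $n$ rows with $2n$ marked cells such that: (1) each column contains exactly one marked cell; (2) each row contains exactly two marked cells; (3) if the cell $(i,j)$ (row $i$, column $j$) is marked, then $i\le j\le n+i$. The normalized median Genocchi number is $h_n:=\#\mathrm{DC}_n$. (It is known that $h_n=H_n(1)$, where $H_0(x)=1$ and $H_n(x)=\frac12(x+1)\big((x+1)H_{n-1}(x+1)-xH_{n-1}(x)\big)$.) *)

theory Defs
  imports
    "Jordan_Normal_Form.Determinant"
    "HOL-Algebra.Left_Coset"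
    "HOL-Algebra.Sym_Groups"
    "HOL-Analysis.Abstract_Topology"
begin

section \<open>The special linear group and its standard subgroups\<close>

text \<open>Matrices have row and column indices in \<open>{0..<m}\<close>, whereas permutations act on \<open>{1..m}\<close>.\<close>

definition SL :: "nat \<Rightarrow> complex mat monoid" where
  "SL m = \<lparr>carrier = {A \<in> carrier_mat m m. det A = 1}, mult = (*), one = 1\<^sub>m m\<rparr>"

definition torus :: "nat \<Rightarrow> complex mat set" where
  "torus m = {A \<in> carrier (SL m). diagonal_mat A}"

definition borel_subgroup :: "nat \<Rightarrow> complex mat set" where
  "borel_subgroup m = {A \<in> carrier (SL m). upper_triangular A}"

text \<open>The stabiliser in \<open>SL (2 * n)\<close> of the flag with members
  \<open>\<langle>e\<^sub>1, \<dots>, e\<^sub>2\<^sub>i\<rangle>\<close>, i.e. the block upper triangular matrices with \<open>2 \<times> 2\<close> diagonal blocks.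
  The lemmas \<open>borel_subset_parabolic\<close> and \<open>weyl_group_parabolic\<close> below identify it as the standard
  parabolic subgroup with Weyl group \<open>W_J n\<close>.\<close>

definition parabolic :: "nat \<Rightarrow> complex mat set" where
  "parabolic n = {A \<in> carrier (SL (2 * n)).
     \<forall>i < 2 * n. \<forall>j < 2 * n. j div 2 < i div 2 \<longrightarrow> A $$ (i, j) = 0}"

definition perm_mat :: "nat \<Rightarrow> (nat \<Rightarrow> nat) \<Rightarrow> complex mat" where
  "perm_mat m \<sigma> = mat m m (\<lambda>(i, j). if i + 1 = \<sigma> (j + 1) then 1 else 0)"

text \<open>A representative of \<open>\<sigma>\<close> in the normaliser of the torus of \<open>SL m\<close>: it maps the line spanned by
  \<open>e\<^sub>j\<close> to the line spanned by \<open>e\<^bsub>\<sigma>(j)\<^esub>\<close>. The first column of the permutation matrix is rescaled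
  by \<open>det (perm_mat m \<sigma>)\<close>, which is \<open>1\<close> or \<open>-1\<close>, in order to obtain determinant \<open>1\<close>.\<close>

definition weyl_rep :: "nat \<Rightarrow> (nat \<Rightarrow> nat) \<Rightarrow> complex mat" where
  "weyl_rep m \<sigma> = multcol 0 (det (perm_mat m \<sigma>)) (perm_mat m \<sigma>)"

definition simple_refl :: "nat \<Rightarrow> nat \<Rightarrow> nat" where
  "simple_refl i = transpose i (i + 1)"

definition W_J :: "nat \<Rightarrow> (nat \<Rightarrow> nat) set" where
  "W_J n = generate (sym_group (2 * n)) {simple_refl (2 * k - 1) | k. k \<in> {1..n}}"


section \<open>The variety of partial flags and its Zariski topology\<close>

inductive_set polynomial_functions :: "nat \<Rightarrow> (complex mat \<Rightarrow> complex) set" for m where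
  const: "(\<lambda>A. c) \<in> polynomial_functions m"
| entry: "i < m \<Longrightarrow> j < m \<Longrightarrow> (\<lambda>A. A $$ (i, j)) \<in> polynomial_functions m"
| add: "f \<in> polynomial_functions m \<Longrightarrow> g \<in> polynomial_functions m \<Longrightarrow>
    (\<lambda>A. f A + g A) \<in> polynomial_functions m"
| mult: "f \<in> polynomial_functions m \<Longrightarrow> g \<in> polynomial_functions m \<Longrightarrow>
    (\<lambda>A. f A * g A) \<in> polynomial_functions m"

definition zariski_SL :: "nat \<Rightarrow> complex mat topology" where
  "zariski_SL m = topology_generated_by
     {{A \<in> carrier (SL m). f A \<noteq> 0} | f. f \<in> polynomial_functions m}"

text \<open>The points of \<open>SL\<^sub>2\<^sub>n/P\<close> are the left cosets of \<open>P\<close>; as for every quotient of a linear algebraic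
  group by a closed subgroup, its Zariski topology is the quotient topology.\<close>

definition flag_variety :: "nat \<Rightarrow> complex mat set set" where
  "flag_variety n = lcosets\<^bsub>SL (2 * n)\<^esub> (parabolic n)"

definition zariski_flag :: "nat \<Rightarrow> complex mat set topology" where
  "zariski_flag n = topology (\<lambda>U. U \<subseteq> flag_variety n \<and>
     openin (zariski_SL (2 * n))
       {g \<in> carrier (SL (2 * n)). g <#\<^bsub>SL (2 * n)\<^esub> parabolic n \<in> U})"

definition perm_point :: "nat \<Rightarrow> (nat \<Rightarrow> nat) \<Rightarrow> complex mat set" where
  "perm_point n \<sigma> = weyl_rep (2 * n) \<sigma> <#\<^bsub>SL (2 * n)\<^esub> parabolic n"

definition schubert_variety :: "nat \<Rightarrow> (nat \<Rightarrow> nat) \<Rightarrow> complex mat set set" where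
  "schubert_variety n \<sigma> = zariski_flag n closure_of
     {b <#\<^bsub>SL (2 * n)\<^esub> perm_point n \<sigma> | b. b \<in> borel_subgroup (2 * n)}"

definition torus_fixed_points :: "nat \<Rightarrow> complex mat set set \<Rightarrow> complex mat set set" where
  "torus_fixed_points n X = {x \<in> X. \<forall>t \<in> torus (2 * n). t <#\<^bsub>SL (2 * n)\<^esub> x = x}"

definition tau :: "nat \<Rightarrow> nat \<Rightarrow> nat" where
  "tau n j = (if j \<in> {1..2 * n} then if odd j then (j + 1) div 2 else n + j div 2 else j)"


section \<open>Dellac configurations\<close>

text \<open>A configuration is the set of its marked cells (row, column).\<close>

definition dellac :: "nat \<Rightarrow> (nat \<times> nat) set set" where
  "dellac n = {C. C \<subseteq> {1..n} \<times> {1..2 * n} \<and> card C = 2 * n \<and>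
     (\<forall>j \<in> {1..2 * n}. \<exists>!i. (i, j) \<in> C) \<and>
     (\<forall>i \<in> {1..n}. card {j. (i, j) \<in> C} = 2) \<and>
     (\<forall>(i, j) \<in> C. i \<le> j \<and> j \<le> n + i)}"

definition normalized_median_genocchi :: "nat \<Rightarrow> nat" where
  "normalized_median_genocchi n = card (dellac n)"

definition is_dellac_perm :: "nat \<Rightarrow> (nat \<times> nat) set \<Rightarrow> (nat \<Rightarrow> nat) \<Rightarrow> bool" where
  "is_dellac_perm n C \<sigma> \<longleftrightarrow> \<sigma> permutes {1..2 * n} \<and>
     (\<forall>k \<in> {1..n}. \<sigma> (2 * k - 1) < \<sigma> (2 * k) \<and>
        {\<sigma> (2 * k - 1), \<sigma> (2 * k)} = {j. (k, j) \<in> C})"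

definition dellac_perm :: "nat \<Rightarrow> (nat \<times> nat) set \<Rightarrow> nat \<Rightarrow> nat" where
  "dellac_perm n C = (THE \<sigma>. is_dellac_perm n C \<sigma>)"

definition dellac_point :: "nat \<Rightarrow> (nat \<times> nat) set \<Rightarrow> complex mat set" where
  "dellac_point n C = perm_point n (dellac_perm n C)"


section \<open>Consistency of the definitions\<close>

lemma openin_zariski_flag:
  "openin (zariski_flag n) U \<longleftrightarrow> U \<subseteq> flag_variety n \<and>
     openin (zariski_SL (2 * n))
       {g \<in> carrier (SL (2 * n)). g <#\<^bsub>SL (2 * n)\<^esub> parabolic n \<in> U}"
proof -
  let ?\<pi> = "\<lambda>U. {g \<in> carrier (SL (2 * n)). g <#\<^bsub>SL (2 * n)\<^esub> parabolic n \<in> U}"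
  have 1: "?\<pi> (S \<inter> T) = ?\<pi> S \<inter> ?\<pi> T" for S T by auto
  have 2: "?\<pi> (\<Union>K) = (\<Union>S\<in>K. ?\<pi> S)" for K by auto
  have "istopology (\<lambda>U. U \<subseteq> flag_variety n \<and> openin (zariski_SL (2 * n)) (?\<pi> U))"
    unfolding istopology_def 1 2 by (auto intro!: openin_Int openin_Union)
  then show ?thesis unfolding zariski_flag_def by simp
qed

lemma topspace_zariski_SL: "topspace (zariski_SL m) = carrier (SL m)"
proof -
  have "(\<lambda>A. 1) \<in> polynomial_functions m" by (rule polynomial_functions.const)
  then have "carrier (SL m) \<in> {{A \<in> carrier (SL m). f A \<noteq> 0} | f. f \<in> polynomial_functions m}"
    by (intro CollectI exI[of _ "\<lambda>A. 1"]) auto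
  then show ?thesis unfolding zariski_SL_def topology_generated_by_topspace by blast
qed

lemma topspace_zariski_flag: "topspace (zariski_flag n) = flag_variety n"
proof -
  have "{g \<in> carrier (SL (2 * n)). g <#\<^bsub>SL (2 * n)\<^esub> parabolic n \<in> flag_variety n} = topspace (zariski_SL (2 * n))"
    by (auto simp: topspace_zariski_SL flag_variety_def LCOSETS_def)
  then have "openin (zariski_flag n) (flag_variety n)"
    by (simp add: openin_zariski_flag)
  then show ?thesis
    by (metis openin_subset openin_topspace openin_zariski_flag subset_antisym)
qed

lemma perm_mat_orthogonal:
  assumes "\<sigma> permutes {1..m}"
  shows "transpose_mat (perm_mat m \<sigma>) * perm_mat m \<sigma> = 1\<^sub>m m"
proof (rule eq_matI)
  fix i j assume ij: "i < dim_row (1\<^sub>m m :: complex mat)" "j < dim_col (1\<^sub>m m :: complex mat)"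
  then have ij': "i < m" "j < m" by auto
  have s: "\<sigma> (Suc i) \<in> {1..m}" using permutes_in_image[OF assms, of "Suc i"] ij' by auto
  have "(transpose_mat (perm_mat m \<sigma>) * perm_mat m \<sigma>) $$ (i, j) =
    (\<Sum>k = 0..<m. (if Suc k = \<sigma> (Suc i) then 1 else 0) * (if Suc k = \<sigma> (Suc j) then 1 else 0))"
    using ij' by (simp add: perm_mat_def scalar_prod_def)
  also have "\<dots> = (\<Sum>k = 0..<m. if k = \<sigma> (Suc i) - 1 then (if i = j then 1 else 0) else 0)"
  proof (rule sum.cong)
    fix k
    have "\<sigma> (Suc i) = \<sigma> (Suc j) \<longleftrightarrow> i = j"
      using permutes_inj[OF assms] by (simp add: inj_eq)
    moreover have "Suc k = \<sigma> (Suc i) \<longleftrightarrow> k = \<sigma> (Suc i) - 1" using s by (simp; linarith)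
    ultimately show "(if Suc k = \<sigma> (Suc i) then 1 else 0) * (if Suc k = \<sigma> (Suc j) then 1 else 0)
        = (if k = \<sigma> (Suc i) - 1 then (if i = j then 1 else 0) else (0 :: complex))"
      by (cases "Suc k = \<sigma> (Suc i)") auto
  qed simp
  also have "\<dots> = (if i = j then 1 else 0)"
  proof -
    have "\<sigma> (Suc i) - 1 \<in> {0..<m}" using s by (simp; linarith)
    then show ?thesis by (subst sum.delta) simp_all
  qed
  also have "\<dots> = (1\<^sub>m m :: complex mat) $$ (i, j)" using ij' by simp
  finally show "(transpose_mat (perm_mat m \<sigma>) * perm_mat m \<sigma>) $$ (i, j) = 1\<^sub>m m $$ (i, j)" .
qed (auto simp: perm_mat_def)

lemma det_weyl_rep:
  assumes "0 < m"
  shows "det (weyl_rep m \<sigma>) = det (perm_mat m \<sigma>) * det (perm_mat m \<sigma>)"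
proof -
  have c: "perm_mat m \<sigma> \<in> carrier_mat m m" by (simp add: perm_mat_def)
  have "weyl_rep m \<sigma> = perm_mat m \<sigma> * multrow_mat m 0 (det (perm_mat m \<sigma>))"
    unfolding weyl_rep_def using c by (rule multcol_mat)
  then show ?thesis
    using c assms by (simp add: det_mult[of _ m] det_multrow_mat)
qed

lemma weyl_rep_in_SL:
  assumes "\<sigma> permutes {1..m}" "0 < m"
  shows "weyl_rep m \<sigma> \<in> carrier (SL m)"
proof -
  have c: "perm_mat m \<sigma> \<in> carrier_mat m m" by (simp add: perm_mat_def)
  have "det (transpose_mat (perm_mat m \<sigma>) * perm_mat m \<sigma>) = 1"
    by (simp add: perm_mat_orthogonal[OF assms(1)])
  then have "det (perm_mat m \<sigma>) * det (perm_mat m \<sigma>) = 1"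
    using c by (simp add: det_mult[of _ m] det_transpose[of _ m])
  then show ?thesis
    using c det_weyl_rep[OF assms(2), of \<sigma>] by (simp add: SL_def weyl_rep_def mat_multcol_def)
qed

lemma borel_subset_parabolic: "borel_subgroup (2 * n) \<subseteq> parabolic n"
proof
  fix A assume "A \<in> borel_subgroup (2 * n)"
  then have A: "A \<in> carrier (SL (2 * n))" "upper_triangular A" "dim_row A = 2 * n"
    by (auto simp: borel_subgroup_def SL_def)
  have "A $$ (i, j) = 0" if "i < 2 * n" "j div 2 < i div 2" for i j
  proof (rule upper_triangularD[OF A(2)])
    show "j < i" using that(2) div_le_mono[of i j 2] by linarith
    show "i < dim_row A" using that(1) A(3) by simp
  qed
  with A(1) show "A \<in> parabolic n" by (simp add: parabolic_def)
qed

lemma tau_odd: "1 \<le> k \<Longrightarrow> k \<le> n \<Longrightarrow> tau n (2 * k - 1) = k"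
  by (auto simp: tau_def)

lemma tau_even: "1 \<le> k \<Longrightarrow> k \<le> n \<Longrightarrow> tau n (2 * k) = n + k"
  by (auto simp: tau_def)

lemma tau_permutes: "tau n permutes {1..2 * n}"
proof -
  let ?g = "\<lambda>v. if v \<le> n then 2 * v - 1 else 2 * (v - n)"
  have c: "\<exists>k. 1 \<le> k \<and> k \<le> n \<and> (j = 2 * k - 1 \<or> j = 2 * k)" if "j \<in> {1..2 * n}" for j
    using that by (intro exI[of _ "(j + 1) div 2"]) auto
  have g: "?g (tau n j) = j \<and> tau n j \<in> {1..2 * n}" if j: "j \<in> {1..2 * n}" for j
    using c[OF j] by (elim exE conjE disjE) (simp_all add: tau_odd[simplified] tau_even)
  have inj: "inj_on (tau n) {1..2 * n}"
    by (rule inj_on_inverseI[of _ ?g]) (rule conjunct1[OF g])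
  have "tau n ` {1..2 * n} = {1..2 * n}"
    using g by (intro endo_inj_surj inj image_subsetI) blast+
  with inj have "bij_betw (tau n) {1..2 * n} {1..2 * n}" by (simp only: bij_betw_def)
  then show ?thesis by (rule bij_imp_permutes) (auto simp: tau_def)
qed

text \<open>\<open>tau_word n\<close> is the product
  \<open>(s\<^sub>n \<dots> s\<^bsub>2n-2\<^esub>) \<dots> (s\<^sub>k \<dots> s\<^bsub>2k-2\<^esub>) \<dots> (s\<^sub>3 s\<^sub>4) s\<^sub>2\<close> of simple reflections.\<close>

fun tau_word :: "nat \<Rightarrow> nat \<Rightarrow> nat" where
  "tau_word 0 = id"
| "tau_word (Suc 0) = id"
| "tau_word (Suc (Suc m)) =
     foldr (\<lambda>i p. simple_refl i \<circ> p) [m + 2..<2 * m + 3] id \<circ> tau_word (Suc m)"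

lemma refl_word:
  "a \<le> b \<Longrightarrow> foldr (\<lambda>i p. simple_refl i \<circ> p) [a..<b] id j =
     (if j = b then a else if a \<le> j \<and> j < b then j + 1 else j)"
proof (induction "b - a" arbitrary: a)
  case 0
  then show ?case by auto
next
  case (Suc d)
  then have e: "[a..<b] = a # [Suc a..<b]" by (simp add: upt_conv_Cons)
  have "d = b - Suc a" "Suc a \<le> b" using Suc by auto
  from Suc(1)[OF this] Suc(2) show ?case
    unfolding e by (auto simp: simple_refl_def transpose_def)
qed

lemma tau_eq_tau_word: "tau n = tau_word n"
proof (induction n rule: tau_word.induct)
  case 1
  show ?case by (auto simp: tau_def fun_eq_iff)
next
  case 2
  show ?case
  proof
    fix j
    show "tau (Suc 0) j = tau_word (Suc 0) j"
      unfolding tau_def atLeastAtMost_iff tau_word.simps id_apply by presburger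
  qed
next
  case (3 m)
  show ?case
  proof
    fix j
    have w: "tau_word (Suc (Suc m)) j =
        (if tau (Suc m) j = 2 * m + 3 then m + 2
         else if m + 2 \<le> tau (Suc m) j \<and> tau (Suc m) j < 2 * m + 3 then tau (Suc m) j + 1
         else tau (Suc m) j)"
      unfolding tau_word.simps(3) 3[symmetric] by (subst comp_apply) (rule refl_word, simp)
    consider k where "j = 2 * k + 1" | k where "j = 2 * k" by (metis oddE evenE)
    then show "tau (Suc (Suc m)) j = tau_word (Suc (Suc m)) j"
    proof cases
      case 1
      consider "k \<le> m" | "k = m + 1" | "m + 1 < k" by linarith
      then show ?thesis unfolding w using 1 by cases (auto simp: tau_def)
    next
      case 2
      consider "k = 0" | "1 \<le> k" "k \<le> m + 1" | "k = m + 2" | "m + 2 < k" by linarith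
      then show ?thesis unfolding w using 2 by cases (auto simp: tau_def)
    qed
  qed
qed

lemma W_J_eq: "W_J n = {\<sigma>. \<sigma> permutes {1..2 * n} \<and>
    (\<forall>k \<in> {1..n}. \<sigma> ` {2 * k - 1, 2 * k} = {2 * k - 1, 2 * k})}" (is "_ = ?R")
proof
  let ?J = "{simple_refl (2 * k - 1) | k. k \<in> {1..n}}"
  have J: "simple_refl (2 * k - 1) permutes {1..2 * n}" if "k \<in> {1..n}" for k
    using that unfolding simple_refl_def by (intro permutes_swap_id) auto
  have JR: "simple_refl (2 * k - 1) \<in> ?R" if k: "k \<in> {1..n}" for k
  proof -
    have "simple_refl (2 * k - 1) ` {2 * l - 1, 2 * l} = {2 * l - 1, 2 * l}" if "l \<in> {1..n}" for l
    proof (cases "l = k")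
      case True
      then show ?thesis using k by (auto simp: simple_refl_def)
    next
      case False
      then have "2 * l - 1 \<noteq> 2 * k - 1" "2 * l - 1 \<noteq> 2 * k" "2 * l \<noteq> 2 * k - 1" "2 * l \<noteq> 2 * k"
        using k that unfolding atLeastAtMost_iff by presburger+
      then show ?thesis using k by (simp add: simple_refl_def)
    qed
    then show ?thesis using J[OF k] by blast
  qed
  have comp: "f \<circ> g \<in> ?R" if "f \<in> ?R" "g \<in> ?R" for f g
  proof -
    have "(f \<circ> g) ` {2 * k - 1, 2 * k} = {2 * k - 1, 2 * k}" if "k \<in> {1..n}" for k
    proof -
      have "f ` {2 * k - 1, 2 * k} = {2 * k - 1, 2 * k}" "g ` {2 * k - 1, 2 * k} = {2 * k - 1, 2 * k}"
        using \<open>f \<in> ?R\<close> \<open>g \<in> ?R\<close> that by blast+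
      then show ?thesis by (simp only: image_comp[symmetric])
    qed
    moreover have "f \<circ> g permutes {1..2 * n}" using that by (blast intro: permutes_compose)
    ultimately show ?thesis by blast
  qed
  show "W_J n \<subseteq> ?R"
  proof
    fix \<sigma> assume "\<sigma> \<in> W_J n"
    then have "\<sigma> \<in> generate (sym_group (2 * n)) ?J" by (simp only: W_J_def)
    then show "\<sigma> \<in> ?R"
    proof induction
      case one
      have "id permutes {1..2 * n}" by (rule permutes_id)
      then show ?case by (simp add: sym_group_one del: id_apply) (simp add: id_def)
    next
      case (incl h)
      then show ?case using JR by blast
    next
      case (inv h)
      then obtain k where k: "k \<in> {1..n}" "h = simple_refl (2 * k - 1)" by blast
      have "inv\<^bsub>sym_group (2 * n)\<^esub> h = h"
        using J[OF k(1)]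
        by (intro group.inv_equality[OF sym_group_is_group])
           (simp_all add: sym_group_def k(2), simp add: simple_refl_def)
      then show ?case using JR k by simp
    next
      case (eng h1 h2)
      then show ?case unfolding sym_group_mult by (intro comp)
    qed
  qed
  have *: "\<sigma> \<in> W_J n" if "m \<le> n" "\<sigma> \<in> ?R" "\<forall>j > 2 * m. \<sigma> j = j" for m \<sigma>
    using that
  proof (induction m arbitrary: \<sigma>)
    case 0
    then have "\<sigma> 0 = 0" by (auto simp: permutes_def)
    with 0 have "\<sigma> = id" by (metis eq_id_iff bot_nat_0.not_eq_extremum mult_0_right)
    then show ?case
      using generate.one[of "sym_group (2 * n)"] unfolding W_J_def sym_group_one by blast
  next
    case (Suc m)
    let ?s = "simple_refl (2 * Suc m - 1)"
    have k: "Suc m \<in> {1..n}" using Suc.prems by auto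
    have img: "\<sigma> ` {2 * Suc m - 1, 2 * Suc m} = {2 * Suc m - 1, 2 * Suc m}"
      using Suc.prems(2) k by blast
    have inj: "inj \<sigma>" using Suc.prems(2) permutes_inj by blast
    have ne: "2 * Suc m - 1 \<noteq> 2 * Suc m" by simp
    have bound: "j = 2 * Suc m - 1 \<or> j = 2 * Suc m \<or> 2 * Suc m < j" if "2 * m < j" for j
      using that by presburger
    have IH: "\<rho> \<in> W_J n"
      if "\<rho> \<in> ?R" "\<rho> (2 * Suc m - 1) = 2 * Suc m - 1" "\<rho> (2 * Suc m) = 2 * Suc m"
        "\<forall>j > 2 * Suc m. \<rho> j = j" for \<rho>
    proof (rule Suc.IH)
      show "m \<le> n" using Suc.prems(1) by simp
      show "\<forall>j > 2 * m. \<rho> j = j"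
      proof (intro allI impI)
        fix j assume "2 * m < j"
        from bound[OF this] show "\<rho> j = j"
          by (elim disjE) (use that(2-4) in blast)+
      qed
    qed fact
    show ?case
    proof (cases "\<sigma> (2 * Suc m) = 2 * Suc m")
      case True
      have "\<sigma> (2 * Suc m - 1) \<in> {2 * Suc m - 1, 2 * Suc m}" using img by blast
      moreover have "\<sigma> (2 * Suc m - 1) \<noteq> 2 * Suc m"
      proof
        assume "\<sigma> (2 * Suc m - 1) = 2 * Suc m"
        then have "\<sigma> (2 * Suc m - 1) = \<sigma> (2 * Suc m)" using True by (rule trans[OF _ sym])
        from injD[OF inj this] ne show False by contradiction
      qed
      ultimately show ?thesis using IH[OF Suc.prems(2)] True Suc.prems(3) by blast
    next
      case False
      have "\<sigma> (2 * Suc m) \<in> {2 * Suc m - 1, 2 * Suc m}" using img by blast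
      with False have sw1: "\<sigma> (2 * Suc m) = 2 * Suc m - 1" by blast
      have "2 * Suc m \<in> \<sigma> ` {2 * Suc m - 1, 2 * Suc m}" unfolding img by blast
      then have "2 * Suc m = \<sigma> (2 * Suc m - 1) \<or> 2 * Suc m = \<sigma> (2 * Suc m)" by blast
      then have sw2: "\<sigma> (2 * Suc m - 1) = 2 * Suc m" using not_sym[OF False] by (elim disjE) (rule sym, assumption, erule notE, assumption)
      have s: "?s = transpose (2 * Suc m - 1) (2 * Suc m)" by (simp add: simple_refl_def)
      have "?s \<circ> \<sigma> \<in> W_J n"
      proof (rule IH)
        show "?s \<circ> \<sigma> \<in> ?R" using JR[OF k] Suc.prems(2) by (rule comp)
        show "(?s \<circ> \<sigma>) (2 * Suc m - 1) = 2 * Suc m - 1"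
          unfolding s comp_apply sw2 by (rule transpose_apply_second)
        show "(?s \<circ> \<sigma>) (2 * Suc m) = 2 * Suc m"
          unfolding s comp_apply sw1 by (rule transpose_apply_first)
        show "\<forall>j > 2 * Suc m. (?s \<circ> \<sigma>) j = j"
          using Suc.prems(3) unfolding s comp_apply by (simp add: transpose_def)
      qed
      moreover have "?s \<in> W_J n" unfolding W_J_def using k by (blast intro: generate.incl)
      ultimately have "?s \<circ> (?s \<circ> \<sigma>) \<in> W_J n"
        unfolding W_J_def
        using generate.eng[where G = "sym_group (2 * n)", unfolded sym_group_mult] by blast
      moreover have "?s \<circ> (?s \<circ> \<sigma>) = \<sigma>" by (simp add: fun_eq_iff simple_refl_def)
      ultimately show ?thesis by simp
    qed
  qed
  show "?R \<subseteq> W_J n"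
  proof
    fix \<sigma> assume R: "\<sigma> \<in> ?R"
    then have "\<sigma> permutes {1..2 * n}" by blast
    then have "\<forall>j > 2 * n. \<sigma> j = j" by (simp add: permutes_def)
    with R show "\<sigma> \<in> W_J n" by (intro *[of n]) simp_all
  qed
qed

lemma weyl_group_parabolic:
  assumes "\<sigma> permutes {1..2 * n}" "1 \<le> n"
  shows "weyl_rep (2 * n) \<sigma> \<in> parabolic n \<longleftrightarrow> \<sigma> \<in> W_J n"
proof -
  have SL: "weyl_rep (2 * n) \<sigma> \<in> carrier (SL (2 * n))"
    using assms by (intro weyl_rep_in_SL) auto
  have det: "det (perm_mat (2 * n) \<sigma>) \<noteq> 0"
    using SL det_weyl_rep[of "2 * n" \<sigma>] assms(2) by (auto simp: SL_def)
  have "weyl_rep (2 * n) \<sigma> $$ (i, j) = 0 \<longleftrightarrow> i + 1 \<noteq> \<sigma> (j + 1)" if "i < 2 * n" "j < 2 * n" for i j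
    using that det by (simp add: weyl_rep_def perm_mat_def mat_multcol_def)
  then have P: "weyl_rep (2 * n) \<sigma> \<in> parabolic n \<longleftrightarrow>
      (\<forall>i < 2 * n. \<forall>j < 2 * n. j div 2 < i div 2 \<longrightarrow> i + 1 \<noteq> \<sigma> (j + 1))"
    using SL by (auto simp: parabolic_def)
  have rng: "\<sigma> j \<in> {1..2 * n}" if "j \<in> {1..2 * n}" for j
    using permutes_in_image[OF assms(1)] that by blast
  show ?thesis
  proof
    assume "weyl_rep (2 * n) \<sigma> \<in> parabolic n"
    then have Q: "\<not> j div 2 < i div 2" if "i < 2 * n" "j < 2 * n" "i + 1 = \<sigma> (j + 1)" for i j
      using P that by blast
    have fl: "\<sigma> ` {1..2 * k} = {1..2 * k}" if "k \<le> n" for k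
    proof (rule endo_inj_surj)
      show "\<sigma> ` {1..2 * k} \<subseteq> {1..2 * k}"
      proof
        fix y assume "y \<in> \<sigma> ` {1..2 * k}"
        then obtain j where j: "j \<in> {1..2 * k}" "y = \<sigma> j" by blast
        then have "y \<in> {1..2 * n}" using rng that by auto
        moreover have "\<not> (j - 1) div 2 < (y - 1) div 2"
        proof -
          have "y - 1 < 2 * n" "j - 1 < 2 * n" "y - 1 + 1 = y" "j - 1 + 1 = j"
            using j(1) \<open>y \<in> {1..2 * n}\<close> that unfolding atLeastAtMost_iff by linarith+
          then show ?thesis using Q[of "y - 1" "j - 1"] j(2) by simp
        qed
        ultimately show "y \<in> {1..2 * k}" using j(1) unfolding atLeastAtMost_iff by presburger
      qed
      show "inj_on \<sigma> {1..2 * k}" using permutes_inj[OF assms(1)] by (rule inj_on_subset) simp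
    qed simp
    have "\<sigma> ` {2 * k - 1, 2 * k} = {2 * k - 1, 2 * k}" if "k \<in> {1..n}" for k
    proof -
      have e: "{2 * k - 1, 2 * k} = {1..2 * k} - {1..2 * (k - 1)}" using that by auto
      have "k \<le> n" "k - 1 \<le> n" using that by auto
      then show ?thesis
        unfolding e image_set_diff[OF permutes_inj[OF assms(1)]] by (simp only: fl)
    qed
    then show "\<sigma> \<in> W_J n" using assms(1) by (simp add: W_J_eq)
  next
    assume "\<sigma> \<in> W_J n"
    then have b: "\<sigma> ` {2 * k - 1, 2 * k} = {2 * k - 1, 2 * k}" if "k \<in> {1..n}" for k
      using that unfolding W_J_eq by blast
    have "i + 1 \<noteq> \<sigma> (j + 1)" if "i < 2 * n" "j < 2 * n" "j div 2 < i div 2" for i j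
    proof -
      let ?k = "j div 2 + 1"
      have "j + 1 \<in> {2 * ?k - 1, 2 * ?k}" by (auto; presburger)
      then have "\<sigma> (j + 1) \<in> {2 * ?k - 1, 2 * ?k}" using b[of ?k] that by (auto; blast)
      then show ?thesis using that(3) by auto
    qed
    then show "weyl_rep (2 * n) \<sigma> \<in> parabolic n" using P by blast
  qed
qed

end

theory Submission
  imports Defs
begin

text \<open>The Schubert variety consists of the flags with
  \<open>\<langle>e\<^sub>1, \<dots>, e\<^sub>k\<rangle> \<subseteq> V\<^sub>2\<^sub>k \<subseteq> \<langle>e\<^sub>1, \<dots>, e\<^bsub>n+k\<^esub>\<rangle>\<close> for all \<open>k\<close>.
  These conditions are closed and \<open>B\<close>-stable, hence hold on the orbit closure. A torus fixed flag is
  a coordinate flag \<open>\<sigma>P\<close>, and for it the conditions read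
  \<open>\<lceil>p/2\<rceil> \<le> \<sigma>(p) \<le> n + \<lceil>p/2\<rceil>\<close>, which is condition (3) of a Dellac configuration. Conversely,
  a permutation satisfying these inequalities is connected to \<open>\<tau>\<^sub>n\<close> by transpositions that preserve
  them and go up in the Bruhat order; each of them is realised by a curve in a \<open>B\<close>-orbit that
  degenerates to the lower fixed point.\<close>

section \<open>The special linear group and its coordinate cosets\<close>

text \<open>The description of the Schubert variety enters as two one-sided facts: the whole orbit
  closure satisfies the inclusions, and every coordinate flag satisfying them lies in the closure.
  The lower inclusion is awkward on a representative \<open>g\<close> but becomes the vanishing of
  entries of its inverse; in determinant one the inverse is the adjugate, hence polynomial, so the
  condition is closed. Iterating degenerations needs transitivity of the closure relation. This is
  arranged in the group instead of the quotient: the vanishing ideal of the double coset of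
  \<open>tau n\<close> defines a set \<open>zariski_hull\<close> that is stable under
  \<open>B\<close> on the left and \<open>P\<close> on the right. All torus elements have
  determinant one, so no single coordinate can be scaled alone; diagonals with entries 2 and 1/2
  separate the weights instead.\<close>

lemma carrier_SL: "A \<in> carrier (SL m) \<longleftrightarrow> A \<in> carrier_mat m m \<and> det A = 1"
  by (simp add: SL_def)

lemma mult_SL [simp]: "A \<otimes>\<^bsub>SL m\<^esub> B = A * B"
  by (simp add: SL_def)

lemma one_SL [simp]: "\<one>\<^bsub>SL m\<^esub> = 1\<^sub>m m"
  by (simp add: SL_def)

lemma adj_mat_SL:
  assumes "A \<in> carrier (SL m)"
  shows "adj_mat A \<in> carrier (SL m)" "A * adj_mat A = 1\<^sub>m m" "adj_mat A * A = 1\<^sub>m m"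
proof -
  have A: "A \<in> carrier_mat m m" "det A = 1" using assms by (simp_all add: carrier_SL)
  show 1: "A * adj_mat A = 1\<^sub>m m" "adj_mat A * A = 1\<^sub>m m"
    using adj_mat(2,3)[OF A(1)] A(2) by auto
  have "det (A * adj_mat A) = 1" unfolding 1 by simp
  then show "adj_mat A \<in> carrier (SL m)"
    using adj_mat(1)[OF A(1)] A by (simp add: carrier_SL det_mult[of _ m])
qed

lemma group_SL: "group (SL m)"
proof (rule groupI)
  show "x \<otimes>\<^bsub>SL m\<^esub> y \<in> carrier (SL m)" if "x \<in> carrier (SL m)" "y \<in> carrier (SL m)" for x y
    using that by (auto simp: carrier_SL det_mult[of _ m])
  show "\<exists>y\<in>carrier (SL m). y \<otimes>\<^bsub>SL m\<^esub> x = \<one>\<^bsub>SL m\<^esub>" if "x \<in> carrier (SL m)" for x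
    using adj_mat_SL[OF that] by auto
qed (auto simp: carrier_SL assoc_mult_mat[of _ m m _ m _ m])

lemma inv_SL: "A \<in> carrier (SL m) \<Longrightarrow> inv\<^bsub>SL m\<^esub> A = adj_mat A"
  by (rule group.inv_equality[OF group_SL]) (auto simp: adj_mat_SL)

lemma mult_in_SL: "A \<in> carrier (SL m) \<Longrightarrow> B \<in> carrier (SL m) \<Longrightarrow> A * B \<in> carrier (SL m)"
  using group.is_monoid[OF group_SL, THEN monoid.m_closed] by simp

lemma one_mult_SL: "A \<in> carrier (SL m) \<Longrightarrow> 1\<^sub>m m * A = A"
  by (auto simp: carrier_SL)

lemma assoc_SL:
  "A \<in> carrier (SL m) \<Longrightarrow> B \<in> carrier (SL m) \<Longrightarrow> C \<in> carrier (SL m) \<Longrightarrow> A * B * C = A * (B * C)"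
  by (auto simp: carrier_SL assoc_mult_mat[of _ m m _ m _ m])

lemma index_mult_SL:
  assumes "A \<in> carrier (SL m)" "B \<in> carrier (SL m)" "i < m" "j < m"
  shows "(A * B) $$ (i, j) = (\<Sum>k<m. A $$ (i, k) * B $$ (k, j))"
  using assms by (auto simp: carrier_SL scalar_prod_def atLeast0LessThan)

section \<open>Stabilisers of coordinate subspaces\<close>

text \<open>Both \<open>B\<close> and \<open>P\<close> are intersections of these stabilisers of
  initial spans, over all \<open>c\<close> and over even \<open>c\<close>, so one argument makes
  both of them subgroups.\<close>

definition coord_stabiliser :: "nat \<Rightarrow> nat \<Rightarrow> complex mat set" where
  "coord_stabiliser m c = {A \<in> carrier (SL m). \<forall>i<m. \<forall>j<m. j < c \<longrightarrow> c \<le> i \<longrightarrow> A $$ (i, j) = 0}"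

lemma coord_stabiliser_mult:
  assumes "A \<in> coord_stabiliser m c" "B \<in> coord_stabiliser m c"
  shows "A * B \<in> coord_stabiliser m c"
proof -
  have AB: "A \<in> carrier (SL m)" "B \<in> carrier (SL m)"
    using assms by (auto simp: coord_stabiliser_def)
  have "(A * B) $$ (i, j) = 0" if "i < m" "j < m" "j < c" "c \<le> i" for i j
    unfolding index_mult_SL[OF AB that(1,2)]
  proof (rule sum.neutral, rule ballI)
    fix k assume "k \<in> {..<m}"
    then show "A $$ (i, k) * B $$ (k, j) = 0"
      using assms that by (cases "k < c") (auto simp: coord_stabiliser_def)
  qed
  then show ?thesis using mult_in_SL[OF AB] by (simp add: coord_stabiliser_def)
qed

text \<open>In block form, \<open>A = (X Y; 0 Z)\<close> has \<open>Z\<close> invertible, and the lower left block \<open>H\<close> of the inverse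
  satisfies \<open>Z * H = 0\<close>.\<close>

lemma coord_stabiliser_inverse:
  assumes A: "A \<in> coord_stabiliser m c"
  shows "adj_mat A \<in> coord_stabiliser m c"
proof (cases "c < m")
  case False
  then show ?thesis using A adj_mat_SL(1) by (auto simp: coord_stabiliser_def)
next
  case True
  define d where "d = m - c"
  have m: "m = c + d" using True by (simp add: d_def)
  have SL: "A \<in> carrier (SL m)" using A by (simp add: coord_stabiliser_def)
  then have cA: "A \<in> carrier_mat (c + d) (c + d)" "det A = 1" by (auto simp: carrier_SL m)
  define X where "X = mat c c (\<lambda>(i, j). A $$ (i, j))"
  define Y where "Y = mat c d (\<lambda>(i, j). A $$ (i, j + c))"
  define Z where "Z = mat d d (\<lambda>(i, j). A $$ (i + c, j + c))"
  define H where "H = mat d c (\<lambda>(i, j). adj_mat A $$ (i + c, j))"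
  have Z: "Z \<in> carrier_mat d d" "H \<in> carrier_mat d c" by (auto simp: Z_def H_def)
  have "A = four_block_mat X Y (0\<^sub>m d c) Z"
    using A cA unfolding X_def Y_def Z_def
    by (intro eq_matI) (auto simp: coord_stabiliser_def m)
  then have "det A = det X * det Z"
    by (metis X_def Y_def Z(1) det_four_block_mat_lower_left_zero mat_carrier)
  then have dZ: "det Z \<noteq> 0" using cA(2) by auto
  have "Z * H = 0\<^sub>m d c"
  proof (rule eq_matI)
    fix i j assume "i < dim_row (0\<^sub>m d c :: complex mat)" "j < dim_col (0\<^sub>m d c :: complex mat)"
    then have ij: "i < d" "j < c" by auto
    have "0 = (A * adj_mat A) $$ (i + c, j)"
      unfolding adj_mat_SL(2)[OF SL] using ij by (simp add: m)
    also have "\<dots> = (\<Sum>k<m. A $$ (i + c, k) * adj_mat A $$ (k, j))"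
      using ij by (intro index_mult_SL[OF SL adj_mat_SL(1)[OF SL]]) (simp_all add: m)
    also have "\<dots> = (\<Sum>k\<in>{c..<c + d}. A $$ (i + c, k) * adj_mat A $$ (k, j))"
      using ij A by (intro sum.mono_neutral_right) (auto simp: m coord_stabiliser_def)
    also have "\<dots> = (\<Sum>k\<in>{0..<d}. A $$ (i + c, k + c) * adj_mat A $$ (k + c, j))"
      by (rule sum.reindex_bij_witness[of _ "\<lambda>k. k + c" "\<lambda>k. k - c"]) auto
    also have "\<dots> = (Z * H) $$ (i, j)"
      using ij by (simp add: Z_def H_def scalar_prod_def)
    finally show "(Z * H) $$ (i, j) = 0\<^sub>m d c $$ (i, j)" using ij by simp
  qed (auto simp: Z_def H_def)
  then have "adj_mat Z * (Z * H) = 0\<^sub>m d c" using adj_mat(1)[OF Z(1)] by simp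
  moreover have "adj_mat Z * (Z * H) = det Z \<cdot>\<^sub>m H"
    using adj_mat(1,3)[OF Z(1)] Z
    by (simp add: mult_smult_assoc_mat[of _ d d _ c] flip: assoc_mult_mat[of _ d d _ d _ c])
  ultimately have "det Z \<cdot>\<^sub>m H = 0\<^sub>m d c" by simp
  then have H0: "H $$ (i, j) = 0" if "i < d" "j < c" for i j
    using that dZ Z(2) by (metis (no_types, lifting) carrier_matD index_smult_mat(1) index_zero_mat(1) mult_eq_0_iff)
  have "adj_mat A $$ (i, j) = 0" if "i < m" "j < m" "j < c" "c \<le> i" for i j
    using H0[of "i - c" j] that by (simp add: H_def m)
  then show ?thesis using adj_mat_SL(1)[OF SL] by (simp add: coord_stabiliser_def)
qed

lemma subgroup_coord_stabilisers:
  assumes "S = {A \<in> carrier (SL m). \<forall>c\<in>K. A \<in> coord_stabiliser m c}"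
  shows "subgroup S (SL m)"
proof (rule group.subgroupI[OF group_SL])
  show "S \<subseteq> carrier (SL m)" using assms by blast
  have "1\<^sub>m m \<in> S" by (auto simp: assms coord_stabiliser_def carrier_SL)
  then show "S \<noteq> {}" by blast
  show "inv\<^bsub>SL m\<^esub> a \<in> S" if "a \<in> S" for a
    using that by (auto simp: assms inv_SL adj_mat_SL coord_stabiliser_inverse)
  show "a \<otimes>\<^bsub>SL m\<^esub> b \<in> S" if "a \<in> S" "b \<in> S" for a b
    using that by (auto simp: assms mult_in_SL coord_stabiliser_mult)
qed

lemma subgroup_borel: "subgroup (borel_subgroup m) (SL m)"
proof (rule subgroup_coord_stabilisers[where K = UNIV])
  show "borel_subgroup m = {A \<in> carrier (SL m). \<forall>c\<in>UNIV. A \<in> coord_stabiliser m c}"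
    by (force simp: borel_subgroup_def coord_stabiliser_def upper_triangular_def carrier_SL)
qed

lemma subgroup_parabolic: "subgroup (parabolic n) (SL (2 * n))"
proof (rule subgroup_coord_stabilisers[where K = "range (\<lambda>k. 2 * k)"])
  have "j div 2 < i div 2 \<longleftrightarrow> (\<exists>k. j < 2 * k \<and> 2 * k \<le> i)" for i j :: nat
  proof
    assume "j div 2 < i div 2"
    then show "\<exists>k. j < 2 * k \<and> 2 * k \<le> i" by (intro exI[of _ "i div 2"]) auto
  next
    assume "\<exists>k. j < 2 * k \<and> 2 * k \<le> i"
    then obtain k where "j < 2 * k" "2 * k \<le> i" by blast
    then have "j div 2 < k" "k \<le> i div 2" by auto
    then show "j div 2 < i div 2" by simp
  qed
  then show "parabolic n = {A \<in> carrier (SL (2 * n)). \<forall>c\<in>range (\<lambda>k. 2 * k). A \<in> coord_stabiliser (2 * n) c}"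
    unfolding parabolic_def coord_stabiliser_def by (simp add: set_eq_iff) blast
qed

section \<open>Permutation representatives and their cosets\<close>

lemma index_weyl_rep:
  assumes "i < m" "j < m"
  shows "weyl_rep m \<sigma> $$ (i, j) =
    (if i + 1 = \<sigma> (j + 1) then if j = 0 then det (perm_mat m \<sigma>) else 1 else 0)"
  using assms by (simp add: weyl_rep_def perm_mat_def mat_multcol_def)

lemma weyl_rep_nonzero_iff:
  assumes "\<sigma> permutes {1..m}" "i < m" "j < m"
  shows "weyl_rep m \<sigma> $$ (i, j) \<noteq> 0 \<longleftrightarrow> i + 1 = \<sigma> (j + 1)"
proof -
  have "0 < m" using assms by simp
  then have "det (perm_mat m \<sigma>) \<noteq> 0"
    using weyl_rep_in_SL[OF assms(1)] det_weyl_rep[of m \<sigma>] by (auto simp: SL_def)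
  then show ?thesis using index_weyl_rep[OF assms(2,3)] by simp
qed

lemma permutes_pred:
  fixes m :: nat
  assumes "\<sigma> permutes {1..m}" "i < m"
  shows "\<sigma> (i + 1) - 1 < m" "\<sigma> (i + 1) - 1 + 1 = \<sigma> (i + 1)"
proof -
  have "\<sigma> (i + 1) \<in> {1..m}" using assms(2) by (subst permutes_in_image[OF assms(1)]) simp
  then show "\<sigma> (i + 1) - 1 < m" "\<sigma> (i + 1) - 1 + 1 = \<sigma> (i + 1)" by auto
qed

text \<open>Each row of a monomial matrix has one nonzero entry. The shifts by one translate between
  matrix indices, which start at 0, and permuted points, which start at 1.\<close>

lemma index_weyl_rep_mult:
  assumes s: "\<sigma> permutes {1..m}" and X: "X \<in> carrier (SL m)" and ij: "i < m" "j < m"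
  shows "(weyl_rep m \<sigma> * X) $$ (\<sigma> (i + 1) - 1, j) = weyl_rep m \<sigma> $$ (\<sigma> (i + 1) - 1, i) * X $$ (i, j)"
proof -
  let ?w = "weyl_rep m \<sigma>"
  have w: "?w \<in> carrier (SL m)" using ij by (intro weyl_rep_in_SL[OF s]) simp
  have "(?w * X) $$ (\<sigma> (i + 1) - 1, j) = (\<Sum>k<m. ?w $$ (\<sigma> (i + 1) - 1, k) * X $$ (k, j))"
    using permutes_pred[OF s ij(1)] by (intro index_mult_SL[OF w X] ij)
  also have "\<dots> = (\<Sum>k\<in>{i}. ?w $$ (\<sigma> (i + 1) - 1, k) * X $$ (k, j))"
  proof (rule sum.mono_neutral_right)
    have "?w $$ (\<sigma> (i + 1) - 1, k) = 0" if k: "k < m" "k \<noteq> i" for k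
      using weyl_rep_nonzero_iff[OF s permutes_pred(1)[OF s ij(1)] k(1)] permutes_pred(2)[OF s ij(1)]
        injD[OF permutes_inj[OF s], of "i + 1" "k + 1"] k(2) by auto
    then show "\<forall>k\<in>{..<m} - {i}. ?w $$ (\<sigma> (i + 1) - 1, k) * X $$ (k, j) = 0" by auto
  qed (use ij in auto)
  finally show ?thesis by simp
qed

text \<open>Multiplying by the inverse of the representative undoes the row permutation and rescales
  rows by nonzero scalars, so membership is block triangularity of the rows put back in
  place.\<close>

lemma perm_point_eq:
  assumes s: "\<sigma> permutes {1..2 * n}" and n: "1 \<le> n"
  shows "perm_point n \<sigma> = {A \<in> carrier (SL (2 * n)).
    \<forall>i < 2 * n. \<forall>j < 2 * n. j div 2 < i div 2 \<longrightarrow> A $$ (\<sigma> (i + 1) - 1, j) = 0}"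
proof -
  let ?m = "2 * n" and ?w = "weyl_rep (2 * n) \<sigma>"
  have w: "?w \<in> carrier (SL ?m)" using n by (intro weyl_rep_in_SL[OF s]) simp
  have nz: "?w $$ (\<sigma> (i + 1) - 1, i) \<noteq> 0" if "i < ?m" for i
    using weyl_rep_nonzero_iff[OF s permutes_pred(1)[OF s that] that] permutes_pred(2)[OF s that] by simp
  have par: "X \<in> parabolic n \<longleftrightarrow> (\<forall>i < ?m. \<forall>j < ?m. j div 2 < i div 2 \<longrightarrow> (?w * X) $$ (\<sigma> (i + 1) - 1, j) = 0)"
    if "X \<in> carrier (SL ?m)" for X
    using that index_weyl_rep_mult[OF s that] nz by (auto simp: parabolic_def)
  let ?R = "{A \<in> carrier (SL ?m).
    \<forall>i < ?m. \<forall>j < ?m. j div 2 < i div 2 \<longrightarrow> A $$ (\<sigma> (i + 1) - 1, j) = 0}"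
  show "perm_point n \<sigma> = ?R"
  proof (rule Set.set_eqI)
    fix A
    show "A \<in> perm_point n \<sigma> \<longleftrightarrow> A \<in> ?R"
    proof
      assume "A \<in> perm_point n \<sigma>"
      then obtain X where X: "X \<in> parabolic n" "A = ?w * X"
        by (auto simp: perm_point_def l_coset_def)
      then have "X \<in> carrier (SL ?m)" by (simp add: parabolic_def)
      then show "A \<in> ?R" using X par mult_in_SL[OF w] by auto
    next
      assume A: "A \<in> ?R"
      let ?X = "adj_mat ?w * A"
      have X: "?X \<in> carrier (SL ?m)" using A adj_mat_SL(1)[OF w] by (auto intro: mult_in_SL)
      have "?w * ?X = A"
        using A adj_mat_SL[OF w] by (simp flip: assoc_SL[OF w]) (auto simp: carrier_SL)
      then show "A \<in> perm_point n \<sigma>"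
        using A par[OF X] unfolding perm_point_def l_coset_def
        by (intro UN_I[of ?X]) auto
    qed
  qed
qed

section \<open>Polynomial functions and the Zariski topology\<close>

lemma polynomial_functions_sum:
  "finite K \<Longrightarrow> (\<And>k. k \<in> K \<Longrightarrow> f k \<in> polynomial_functions m) \<Longrightarrow>
    (\<lambda>A. \<Sum>k\<in>K. f k A) \<in> polynomial_functions m"
  by (induction K rule: finite_induct) (auto intro: polynomial_functions.intros)

lemma polynomial_functions_prod:
  "finite K \<Longrightarrow> (\<And>k. k \<in> K \<Longrightarrow> f k \<in> polynomial_functions m) \<Longrightarrow>
    (\<lambda>A. \<Prod>k\<in>K. f k A) \<in> polynomial_functions m"
  by (induction K rule: finite_induct) (auto intro: polynomial_functions.intros)

lemma polynomial_function_compose: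
  assumes "f \<in> polynomial_functions m"
    and "\<And>i j. i < m \<Longrightarrow> j < m \<Longrightarrow> \<exists>g\<in>polynomial_functions m. \<forall>A\<in>S. h A $$ (i, j) = g A"
  shows "\<exists>g\<in>polynomial_functions m. \<forall>A\<in>S. f (h A) = g A"
  using assms(1)
proof induction
  case (const c)
  show ?case by (intro bexI[of _ "\<lambda>A. c"] polynomial_functions.const) simp
next
  case (entry i j)
  then show ?case by (rule assms(2))
next
  case (add f1 f2)
  then obtain g1 g2 where "g1 \<in> polynomial_functions m" "g2 \<in> polynomial_functions m"
    "\<forall>A\<in>S. f1 (h A) = g1 A" "\<forall>A\<in>S. f2 (h A) = g2 A" by blast
  then show ?case
    by (intro bexI[of _ "\<lambda>A. g1 A + g2 A"] polynomial_functions.add) auto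
next
  case (mult f1 f2)
  then obtain g1 g2 where "g1 \<in> polynomial_functions m" "g2 \<in> polynomial_functions m"
    "\<forall>A\<in>S. f1 (h A) = g1 A" "\<forall>A\<in>S. f2 (h A) = g2 A" by blast
  then show ?case
    by (intro bexI[of _ "\<lambda>A. g1 A * g2 A"] polynomial_functions.mult) auto
qed

lemma polynomial_function_translate:
  assumes f: "f \<in> polynomial_functions m" and g: "g \<in> carrier (SL m)" and h: "h \<in> carrier (SL m)"
  shows "\<exists>f'\<in>polynomial_functions m. \<forall>A\<in>carrier (SL m). f (g * A * h) = f' A"
proof (rule polynomial_function_compose[OF f])
  fix i j assume ij: "i < m" "j < m"
  have "(g * A * h) $$ (i, j) = (\<Sum>k<m. (\<Sum>l<m. g $$ (i, l) * A $$ (l, k)) * h $$ (k, j))"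
    if "A \<in> carrier (SL m)" for A
    unfolding index_mult_SL[OF mult_in_SL[OF g that] h ij]
    using index_mult_SL[OF g that ij(1)] by (intro sum.cong) auto
  moreover have "(\<lambda>A. \<Sum>k<m. (\<Sum>l<m. g $$ (i, l) * A $$ (l, k)) * h $$ (k, j)) \<in> polynomial_functions m"
    using ij by (intro polynomial_functions_sum polynomial_functions.intros) auto
  ultimately show "\<exists>f'\<in>polynomial_functions m. \<forall>A\<in>carrier (SL m). (g * A * h) $$ (i, j) = f' A"
    by (intro bexI) auto
qed

text \<open>An entry of the adjugate is a signed minor, which the Leibniz formula expands. In the
  proof, \<open>s k\<close> numbers the indices that remain after deleting \<open>k\<close>.\<close>

lemma polynomial_function_adj:
  assumes "i < m" "j < m"
  shows "\<exists>f\<in>polynomial_functions m. \<forall>A\<in>carrier (SL m). adj_mat A $$ (i, j) = f A"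
proof -
  define s where "s = (\<lambda>k a :: nat. if a < k then a else Suc a)"
  define f where "f = (\<lambda>A :: complex mat. (-1) ^ (j + i) *
    (\<Sum>p\<in>{p. p permutes {0..<m - 1}}. signof p * (\<Prod>a = 0..<m - 1. A $$ (s j a, s i (p a)))))"
  have "f \<in> polynomial_functions m"
    unfolding f_def
  proof (intro polynomial_functions.mult polynomial_functions.const polynomial_functions_sum
      polynomial_functions_prod polynomial_functions.entry)
    show "finite {p. p permutes {0..<m - 1}}" by (simp add: finite_permutations)
    fix p a assume "p \<in> {p. p permutes {0..<m - 1}}" "a \<in> {0..<m - 1}"
    then have "p a \<in> {0..<m - 1}" "a < m - 1" using permutes_in_image by fastforce+
    then show "s j a < m" "s i (p a) < m" by (auto simp: s_def)
  qed simp
  moreover have "adj_mat A $$ (i, j) = f A" if "A \<in> carrier (SL m)" for A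
  proof -
    have A: "A \<in> carrier_mat m m" using that by (simp add: carrier_SL)
    have "det (mat_delete A j i) = (\<Sum>p\<in>{p. p permutes {0..<m - 1}}.
        signof p * (\<Prod>a = 0..<m - 1. mat_delete A j i $$ (a, p a)))"
      by (rule det_def'[OF mat_delete_carrier[OF A]])
    also have "\<dots> = (\<Sum>p\<in>{p. p permutes {0..<m - 1}}.
        signof p * (\<Prod>a = 0..<m - 1. A $$ (s j a, s i (p a))))"
    proof (intro sum.cong prod.cong arg_cong2[where f = "(*)"] refl)
      fix p a assume "p \<in> {p. p permutes {0..<m - 1}}" "a \<in> {0..<m - 1}"
      then have "p a \<in> {0..<m - 1}" "a < m - 1" using permutes_in_image by fastforce+
      then show "mat_delete A j i $$ (a, p a) = A $$ (s j a, s i (p a))"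
        using A by (simp add: mat_delete_def s_def)
    qed
    finally show ?thesis
      using A assms by (simp add: adj_mat_def cofactor_def f_def)
  qed
  ultimately show ?thesis by blast
qed

text \<open>The row operation moves \<open>A\<close> along a line, so degenerating to
  \<open>s = 0\<close> becomes a question about roots of a polynomial in one variable.\<close>

lemma polynomial_function_along_line:
  assumes f: "f \<in> polynomial_functions m" and A: "A \<in> carrier_mat m m" and k: "k < m" "l < m"
  shows "\<exists>q. \<forall>s. f (addrow s k l A) = poly q s"
  using f
proof induction
  case (const c)
  show ?case by (intro exI[of _ "[:c:]"]) simp
next
  case (entry i j)
  then show ?case
    using A by (intro exI[of _ "if i = k then [:A $$ (k, j), A $$ (l, j):] else [:A $$ (i, j):]"])
      (auto simp: mat_addrow_def)
next
  case (add f g)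
  then obtain p q where "\<forall>s. f (addrow s k l A) = poly p s" "\<forall>s. g (addrow s k l A) = poly q s" by blast
  then show ?case by (intro exI[of _ "p + q"]) simp
next
  case (mult f g)
  then obtain p q where "\<forall>s. f (addrow s k l A) = poly p s" "\<forall>s. g (addrow s k l A) = poly q s" by blast
  then show ?case by (intro exI[of _ "p * q"]) simp
qed

lemma openin_zariski_basic:
  "f \<in> polynomial_functions m \<Longrightarrow> openin (zariski_SL m) {A \<in> carrier (SL m). f A \<noteq> 0}"
  unfolding zariski_SL_def by (rule topology_generated_by_Basis) blast

text \<open>The nonvanishing sets of \<open>f\<close> and \<open>h\<close> meet in that of their
  product, so the generating family is already a base.\<close>

lemma openin_zariski_obtains_basic:
  assumes "openin (zariski_SL m) U" "g \<in> U"
  obtains f where "f \<in> polynomial_functions m" "f g \<noteq> 0" "{A \<in> carrier (SL m). f A \<noteq> 0} \<subseteq> U"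
proof -
  have "generate_topology_on {{A \<in> carrier (SL m). f A \<noteq> 0} | f. f \<in> polynomial_functions m} U"
    using assms(1) unfolding zariski_SL_def by (rule openin_topology_generated_by)
  then have "\<forall>g\<in>U. \<exists>f\<in>polynomial_functions m. f g \<noteq> 0 \<and> {A \<in> carrier (SL m). f A \<noteq> 0} \<subseteq> U"
  proof induction
    case (Int a b)
    show ?case
    proof
      fix g assume "g \<in> a \<inter> b"
      then obtain f h where fh: "f \<in> polynomial_functions m" "h \<in> polynomial_functions m"
        "f g \<noteq> 0" "h g \<noteq> 0" "{A \<in> carrier (SL m). f A \<noteq> 0} \<subseteq> a" "{A \<in> carrier (SL m). h A \<noteq> 0} \<subseteq> b"
        using Int.IH by blast
      then show "\<exists>f\<in>polynomial_functions m. f g \<noteq> 0 \<and> {A \<in> carrier (SL m). f A \<noteq> 0} \<subseteq> a \<inter> b"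
        by (intro bexI[of _ "\<lambda>A. f A * h A"] polynomial_functions.mult) auto
    qed
  next
    case (UN K)
    show ?case
    proof
      fix g assume "g \<in> \<Union>K"
      then obtain k where "k \<in> K" "g \<in> k" by blast
      then show "\<exists>f\<in>polynomial_functions m. f g \<noteq> 0 \<and> {A \<in> carrier (SL m). f A \<noteq> 0} \<subseteq> \<Union>K"
        using UN.IH[of k] by blast
    qed
  qed auto
  then show thesis using that assms(2) by blast
qed

section \<open>Dellac configurations and permutations\<close>

definition dellac_bounded :: "nat \<Rightarrow> (nat \<Rightarrow> nat) \<Rightarrow> bool" where
  "dellac_bounded n \<sigma> \<longleftrightarrow> (\<forall>p\<in>{1..2 * n}. (p + 1) div 2 \<le> \<sigma> p \<and> \<sigma> p \<le> n + (p + 1) div 2)"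

text \<open>The row of the cell in column \<open>v\<close>. For flags it is the least
  \<open>k\<close> such that the \<open>2k\<close>-dimensional member of \<open>\<sigma>P\<close>
  contains \<open>e_v\<close>, and hence a complete invariant of the coset.\<close>

definition row_of :: "(nat \<Rightarrow> nat) \<Rightarrow> nat \<Rightarrow> nat" where
  "row_of \<sigma> v = (Hilbert_Choice.inv \<sigma> v + 1) div 2"

lemma row_of_apply: "inj \<sigma> \<Longrightarrow> row_of \<sigma> (\<sigma> p) = (p + 1) div 2"
  by (simp add: row_of_def)

lemma dellac_bounded_tau: "dellac_bounded n (tau n)"
  unfolding dellac_bounded_def tau_def by auto

lemma card_rows_between:
  assumes s: "\<sigma> permutes {1..2 * n}" and "i \<le> a" "a \<le> n"
  shows "card {v \<in> {1..2 * n}. i < row_of \<sigma> v \<and> row_of \<sigma> v \<le> a} = 2 * (a - i)"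
proof -
  have "{v \<in> {1..2 * n}. i < row_of \<sigma> v \<and> row_of \<sigma> v \<le> a} = \<sigma> ` {2 * i + 1..2 * a}"
    (is "?L = ?R")
  proof
    show "?L \<subseteq> ?R"
    proof
      fix v assume v: "v \<in> ?L"
      have "v = \<sigma> (Hilbert_Choice.inv \<sigma> v)" using permutes_inverses(1)[OF s] by simp
      moreover have "Hilbert_Choice.inv \<sigma> v \<in> {2 * i + 1..2 * a}" using v by (auto simp: row_of_def)
      ultimately show "v \<in> ?R" by (rule image_eqI)
    qed
    show "?R \<subseteq> ?L"
    proof
      fix v assume "v \<in> ?R"
      then obtain p where p: "p \<in> {2 * i + 1..2 * a}" "v = \<sigma> p" by blast
      moreover have "p \<in> {1..2 * n}" using p(1) assms(3) by auto
      ultimately show "v \<in> ?L"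
        using permutes_in_image[OF s, of p] by (auto simp: row_of_apply[OF permutes_inj[OF s]])
    qed
  qed
  moreover have "card (\<sigma> ` {2 * i + 1..2 * a}) = card {2 * i + 1..2 * a}"
    by (rule card_image[OF inj_on_subset[OF permutes_inj[OF s] subset_UNIV]])
  ultimately show ?thesis using assms(2) by simp
qed

text \<open>By \<open>ne\<close>, \<sigma> is outside the coset of \<open>tau n\<close>, whose rows
  are \<open>v\<close> and \<open>v - n\<close>. Some column \<open>a\<close> then sits in a row
  \<open>i < a\<close>, and a count shows that a larger column from one of the rows
  \<open>i + 1\<close> to \<open>a\<close> can take its place.\<close>

lemma dellac_swap:
  assumes s: "\<sigma> permutes {1..2 * n}" and b: "dellac_bounded n \<sigma>"
    and ne: "\<exists>v\<in>{1..2 * n}. row_of \<sigma> v \<noteq> (if v \<le> n then v else v - n)"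
  shows "\<exists>p q. 1 \<le> p \<and> p < q \<and> q \<le> 2 * n \<and> \<sigma> p < \<sigma> q \<and>
    dellac_bounded n (transpose (\<sigma> p) (\<sigma> q) \<circ> \<sigma>)"
proof -
  define r where "r = (\<lambda>v. row_of \<sigma> v)"
  have inv: "Hilbert_Choice.inv \<sigma> v \<in> {1..2 * n}" "\<sigma> (Hilbert_Choice.inv \<sigma> v) = v" if "v \<in> {1..2 * n}" for v
    using permutes_in_image[OF permutes_inv[OF s]] that permutes_inverses(1)[OF s] by auto
  have rb: "1 \<le> r v \<and> r v \<le> n \<and> r v \<le> v \<and> v \<le> n + r v" if "v \<in> {1..2 * n}" for v
  proof -
    have "r v \<le> v \<and> v \<le> n + r v"
      using b inv[OF that] unfolding dellac_bounded_def r_def row_of_def by metis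
    then show ?thesis using inv(1)[OF that] by (auto simp: r_def row_of_def)
  qed
  have fib: "card {v \<in> {1..2 * n}. i < r v \<and> r v \<le> a} = 2 * (a - i)" if "i \<le> a" "a \<le> n" for i a
    using card_rows_between[OF s that] by (simp add: r_def)
  \<comment> \<open>Otherwise \<open>r v \<le> v\<close> forces \<open>r v = v\<close> for
    \<open>v \<le> n\<close>. One place is then left in each row, and column \<open>n + k\<close>
    must fill row \<open>k\<close>, contrary to \<open>ne\<close>.\<close>
  have "\<exists>a. a \<in> {1..n} \<and> r a < a"
  proof (rule ccontr)
    assume no: "\<nexists>a. a \<in> {1..n} \<and> r a < a"
    have low: "r v = v" if "v \<in> {1..n}" for v
      using no rb[of v] that by fastforce
    \<comment> \<open>Induction downwards from \<open>k = n\<close>: a larger row \<open>l\<close>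
      is already full with the columns \<open>l\<close> and \<open>n + l\<close>.\<close>
    have high: "r (n + k) = k" if "k \<in> {1..n}" for k
      using that
    proof (induction "n - k" arbitrary: k rule: less_induct)
      case less
      have rk: "1 \<le> r (n + k)" "r (n + k) \<le> n" "k \<le> r (n + k)" using rb[of "n + k"] less.prems by auto
      show ?case
      proof (rule ccontr)
        assume "r (n + k) \<noteq> k"
        define l where "l = r (n + k)"
        have l: "k < l" "l \<le> n" using rk \<open>r (n + k) \<noteq> k\<close> by (auto simp: l_def)
        have "r (n + l) = l" using less.hyps[of l] l less.prems by auto
        moreover have "r l = l" using low l less.prems by auto
        ultimately have "{l, n + l, n + k} \<subseteq> {v \<in> {1..2 * n}. l - 1 < r v \<and> r v \<le> l}"
          using l less.prems by (auto simp flip: l_def)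
        from card_mono[OF _ this] have "card {l, n + l, n + k} \<le> 2"
          using fib[of "l - 1" l] l by auto
        then show False using l less.prems by auto
      qed
    qed
    have "r v = (if v \<le> n then v else v - n)" if "v \<in> {1..2 * n}" for v
    proof (cases "v \<le> n")
      case True
      then show ?thesis using low that by simp
    next
      case False
      then have "v - n \<in> {1..n}" "n + (v - n) = v" using that by auto
      then show ?thesis using high[of "v - n"] False by simp
    qed
    then show False using ne by (simp add: r_def)
  qed
  then have ex: "\<exists>a. a \<in> {1..n} \<and> r a < a" .
  \<comment> \<open>Minimality gives \<open>r v = v\<close> for all smaller columns, which bounds
    their share in the count below.\<close>
  define a where "a = (LEAST a. a \<in> {1..n} \<and> r a < a)"
  have a: "a \<in> {1..n}" "r a < a" using LeastI_ex[OF ex] by (auto simp: a_def)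
  have min: "r v = v" if "v \<in> {1..<a}" for v
  proof -
    have "\<not> (v \<in> {1..n} \<and> r v < v)"
      using that unfolding a_def by (intro not_less_Least) simp
    then show ?thesis using that rb[of v] a(1) by auto
  qed
  define i where "i = r a"
  have i: "1 \<le> i" "i < a" using a rb[of a] by (auto simp: i_def)
  define R where "R = {v \<in> {1..2 * n}. i < r v \<and> r v \<le> a}"
  \<comment> \<open>Otherwise \<open>R\<close> has at most \<open>a - 1 - i\<close> columns below
    \<open>a\<close> and \<open>a - i\<close> columns from \<open>n + i + 1\<close> to
    \<open>n + a\<close>, one short of the \<open>2 * (a - i)\<close> that its rows hold.\<close>
  have "\<exists>b\<in>R. a < b \<and> b \<le> n + i"
  proof (rule ccontr)
    assume none: "\<not> (\<exists>b\<in>R. a < b \<and> b \<le> n + i)"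
    have "R \<subseteq> {i + 1..<a} \<union> {n + i + 1..n + a}"
    proof
      fix v assume v: "v \<in> R"
      consider "v < a" | "v = a" | "a < v" by linarith
      then show "v \<in> {i + 1..<a} \<union> {n + i + 1..n + a}"
      proof cases
        case 1
        then show ?thesis using min[of v] v by (auto simp: R_def)
      next
        case 2
        then show ?thesis using v by (simp add: R_def i_def)
      next
        case 3
        then show ?thesis using none v rb[of v] by (auto simp: R_def)
      qed
    qed
    from card_mono[OF _ this] have "card R \<le> (a - 1 - i) + (a - i)"
      using card_Un_le[of "{i + 1..<a}" "{n + i + 1..n + a}"] by simp
    moreover have "card R = 2 * (a - i)" unfolding R_def using fib[of i a] i a by auto
    ultimately show False using i by simp
  qed
  then obtain c where c: "c \<in> {1..2 * n}" "i < r c" "r c \<le> a" "a < c" "c \<le> n + i"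
    by (auto simp: R_def)
  have a': "a \<in> {1..2 * n}" using a by auto
  define p q where "p = Hilbert_Choice.inv \<sigma> a" and "q = Hilbert_Choice.inv \<sigma> c"
  have p: "p \<in> {1..2 * n}" "\<sigma> p = a" "(p + 1) div 2 = i" using inv[OF a'] by (auto simp: p_def i_def r_def row_of_def)
  have q: "q \<in> {1..2 * n}" "\<sigma> q = c" "(q + 1) div 2 = r c" using inv[OF c(1)] by (auto simp: q_def r_def row_of_def)
  have "p < q" using p(3) q(3) c(2) by (metis add_le_mono1 div_le_mono leD leI)
  \<comment> \<open>Row \<open>i\<close> receives \<open>c\<close> with
    \<open>i < c \<le> n + i\<close>, and row \<open>r c\<close> receives \<open>a\<close> with
    \<open>r c \<le> a \<le> n\<close>.\<close>
  moreover have "dellac_bounded n (transpose a c \<circ> \<sigma>)"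
    unfolding dellac_bounded_def
  proof
    fix k assume k: "k \<in> {1..2 * n}"
    consider "k = p" | "k = q" | "k \<noteq> p" "k \<noteq> q" by blast
    then show "(k + 1) div 2 \<le> (transpose a c \<circ> \<sigma>) k \<and> (transpose a c \<circ> \<sigma>) k \<le> n + (k + 1) div 2"
    proof cases
      case 1
      then show ?thesis using p c i by simp
    next
      case 2
      then show ?thesis using q c a by simp
    next
      case 3
      then have "\<sigma> k \<noteq> a" "\<sigma> k \<noteq> c" using p(2) q(2) permutes_inj[OF s] by (auto dest: injD)
      then show ?thesis using b k by (simp add: dellac_bounded_def)
    qed
  qed
  ultimately show ?thesis using p q c(4) by (intro exI[of _ p] exI[of _ q]) auto
qed

text \<open>The termination measure for chains of transpositions: the sum loses
  \<open>(q - p) * (\<sigma> q - \<sigma> p)\<close>, as in the rearrangement inequality.\<close>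

lemma weighted_sum_swap:
  assumes "finite S" "p \<in> S" "q \<in> S" "p < q" "\<sigma> p < \<sigma> q" "inj \<sigma>"
  shows "(\<Sum>k\<in>S. k * (transpose (\<sigma> p) (\<sigma> q) \<circ> \<sigma>) k) < (\<Sum>k\<in>S. k * \<sigma> k :: nat)"
proof -
  have *: "sum f S = f p + (f q + sum f (S - {p} - {q}))" for f :: "nat \<Rightarrow> nat"
    using assms sum.remove[of S p f] sum.remove[of "S - {p}" q f] by simp
  have "sum (\<lambda>k. k * (transpose (\<sigma> p) (\<sigma> q) \<circ> \<sigma>) k) (S - {p} - {q}) = sum (\<lambda>k. k * \<sigma> k) (S - {p} - {q})"
  proof (rule sum.cong)
    fix k assume "k \<in> S - {p} - {q}"
    then have "\<sigma> k \<noteq> \<sigma> p" "\<sigma> k \<noteq> \<sigma> q" using injD[OF assms(6), of k] by blast+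
    then show "k * (transpose (\<sigma> p) (\<sigma> q) \<circ> \<sigma>) k = k * \<sigma> k" by (simp add: transpose_def)
  qed simp
  moreover have "p * \<sigma> q + q * \<sigma> p < p * \<sigma> p + q * \<sigma> q"
  proof -
    obtain d e where "q = p + Suc d" "\<sigma> q = \<sigma> p + Suc e"
      using assms(4,5) less_imp_Suc_add[of p q] less_imp_Suc_add[of "\<sigma> p" "\<sigma> q"] by auto
    then show ?thesis by (simp add: algebra_simps)
  qed
  ultimately show ?thesis unfolding * by simp
qed

section \<open>Permutations with prescribed pairs of values\<close>

lemma pair_eq_Min_Max:
  "a < b \<Longrightarrow> {a, b} = R \<Longrightarrow> a = Min R \<and> b = Max (R :: nat set)"
  by auto

text \<open>Disjoint pairs fill the range by cardinality, and the order inside a pair leaves no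
  choice. The family \<open>R\<close> is arbitrary because the lemma serves both the rows of a
  configuration and the rows read off a torus fixed coset.\<close>

lemma ex1_permutation_of_rows:
  fixes R :: "nat \<Rightarrow> nat set"
  assumes R: "\<And>k. k \<in> {1..n} \<Longrightarrow> card (R k) = 2"
    and sub: "\<And>k. k \<in> {1..n} \<Longrightarrow> R k \<subseteq> {1..2 * n}"
    and disj: "\<And>j k l. k \<in> {1..n} \<Longrightarrow> l \<in> {1..n} \<Longrightarrow> j \<in> R k \<Longrightarrow> j \<in> R l \<Longrightarrow> k = l"
  shows "\<exists>!\<sigma>. \<sigma> permutes {1..2 * n} \<and>
    (\<forall>k\<in>{1..n}. \<sigma> (2 * k - 1) < \<sigma> (2 * k) \<and> {\<sigma> (2 * k - 1), \<sigma> (2 * k)} = R k)"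
proof (rule ex_ex1I)
  have mm: "Min (R k) < Max (R k) \<and> {Min (R k), Max (R k)} = R k" if k: "k \<in> {1..n}" for k
  proof -
    obtain x y where xy: "R k = {x, y}" "x \<noteq> y" using R[OF k] by (meson card_2_iff)
    then show ?thesis by (cases "x < y") auto
  qed
  define \<sigma> where "\<sigma> = (\<lambda>p. if p \<in> {1..2 * n} then
    if odd p then Min (R ((p + 1) div 2)) else Max (R ((p + 1) div 2)) else p)"
  have row: "(p + 1) div 2 \<in> {1..n}" if "p \<in> {1..2 * n}" for p using that by auto
  have mem: "\<sigma> p \<in> R ((p + 1) div 2)" if "p \<in> {1..2 * n}" for p
    using mm[OF row[OF that]] that unfolding \<sigma>_def by auto
  have odd: "\<sigma> (2 * k - 1) = Min (R k)" and even: "\<sigma> (2 * k) = Max (R k)" if "k \<in> {1..n}" for k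
    using that by (auto simp: \<sigma>_def)
  have "inj_on \<sigma> {1..2 * n}"
  proof (rule inj_onI)
    fix p q assume pq: "p \<in> {1..2 * n}" "q \<in> {1..2 * n}" "\<sigma> p = \<sigma> q"
    then have e: "(p + 1) div 2 = (q + 1) div 2"
      using mem disj[OF row row] by metis
    moreover have "odd p = odd q"
      using pq mm[OF row[OF pq(1)]] unfolding \<sigma>_def e by (auto split: if_splits)
    ultimately show "p = q" by presburger
  qed
  moreover have "\<sigma> ` {1..2 * n} \<subseteq> {1..2 * n}" using mem sub row by blast
  ultimately have "bij_betw \<sigma> {1..2 * n} {1..2 * n}"
    unfolding bij_betw_def by (intro conjI endo_inj_surj) (assumption | rule finite_atLeastAtMost)+
  then have "\<sigma> permutes {1..2 * n}" by (rule bij_imp_permutes) (auto simp: \<sigma>_def)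
  then show "\<exists>\<sigma>. \<sigma> permutes {1..2 * n} \<and>
    (\<forall>k\<in>{1..n}. \<sigma> (2 * k - 1) < \<sigma> (2 * k) \<and> {\<sigma> (2 * k - 1), \<sigma> (2 * k)} = R k)"
  proof (intro exI[of _ \<sigma>] conjI ballI)
    fix k assume k: "k \<in> {1..n}"
    show "\<sigma> (2 * k - 1) < \<sigma> (2 * k)" "{\<sigma> (2 * k - 1), \<sigma> (2 * k)} = R k"
      unfolding odd[OF k] even[OF k] using mm[OF k] by blast+
  qed
next
  fix \<sigma> \<rho>
  assume s: "\<sigma> permutes {1..2 * n} \<and>
    (\<forall>k\<in>{1..n}. \<sigma> (2 * k - 1) < \<sigma> (2 * k) \<and> {\<sigma> (2 * k - 1), \<sigma> (2 * k)} = R k)"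
   and r: "\<rho> permutes {1..2 * n} \<and>
    (\<forall>k\<in>{1..n}. \<rho> (2 * k - 1) < \<rho> (2 * k) \<and> {\<rho> (2 * k - 1), \<rho> (2 * k)} = R k)"
  have e: "\<sigma> (2 * k - 1) = \<rho> (2 * k - 1) \<and> \<sigma> (2 * k) = \<rho> (2 * k)" if "k \<in> {1..n}" for k
  proof -
    have "\<sigma> (2 * k - 1) = Min (R k) \<and> \<sigma> (2 * k) = Max (R k)"
      using s that by (intro pair_eq_Min_Max) auto
    moreover have "\<rho> (2 * k - 1) = Min (R k) \<and> \<rho> (2 * k) = Max (R k)"
      using r that by (intro pair_eq_Min_Max) auto
    ultimately show ?thesis by simp
  qed
  show "\<sigma> = \<rho>"
  proof
    fix p
    show "\<sigma> p = \<rho> p"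
    proof (cases "p \<in> {1..2 * n}")
      case True
      then have k: "(p + 1) div 2 \<in> {1..n}" by auto
      have "p = 2 * ((p + 1) div 2) - 1 \<or> p = 2 * ((p + 1) div 2)" using True by auto
      then show ?thesis using e[OF k] by metis
    next
      case False
      then show ?thesis using permutes_not_in[of \<sigma>] permutes_not_in[of \<rho>] s r by metis
    qed
  qed
qed

lemma dellac_row:
  assumes "C \<in> dellac n" "k \<in> {1..n}"
  shows "{j. (k, j) \<in> C} \<subseteq> {1..2 * n}" "card {j. (k, j) \<in> C} = 2"
  using assms by (auto simp: dellac_def)

lemma ex1_dellac_perm:
  assumes "C \<in> dellac n"
  shows "\<exists>!\<sigma>. is_dellac_perm n C \<sigma>"
  unfolding is_dellac_perm_def
proof (rule ex1_permutation_of_rows)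
  fix k assume "k \<in> {1..n}"
  then show "card {j. (k, j) \<in> C} = 2" "{j. (k, j) \<in> C} \<subseteq> {1..2 * n}"
    using dellac_row[OF assms] by blast+
next
  fix j k l assume "k \<in> {1..n}" "j \<in> {j. (k, j) \<in> C}" "j \<in> {j. (l, j) \<in> C}"
  moreover from this have "j \<in> {1..2 * n}" using dellac_row[OF assms] by blast
  ultimately show "k = l" using assms unfolding dellac_def by blast
qed

lemma is_dellac_perm_dellac_perm: "C \<in> dellac n \<Longrightarrow> is_dellac_perm n C (dellac_perm n C)"
  unfolding dellac_perm_def by (rule theI'[OF ex1_dellac_perm])

lemma is_dellac_perm_mem_iff:
  assumes "is_dellac_perm n C \<sigma>" "k \<in> {1..n}" "p \<in> {1..2 * n}"
  shows "(k, \<sigma> p) \<in> C \<longleftrightarrow> k = (p + 1) div 2"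
proof -
  have s: "\<sigma> permutes {1..2 * n}" "{\<sigma> (2 * k - 1), \<sigma> (2 * k)} = {j. (k, j) \<in> C}"
    using assms(1,2) by (auto simp: is_dellac_perm_def)
  have "(k, \<sigma> p) \<in> C \<longleftrightarrow> \<sigma> p \<in> \<sigma> ` {2 * k - 1, 2 * k}" using s(2) by auto
  also have "\<dots> \<longleftrightarrow> p \<in> {2 * k - 1, 2 * k}" by (rule inj_image_mem_iff[OF permutes_inj[OF s(1)]])
  also have "\<dots> \<longleftrightarrow> k = (p + 1) div 2" using assms(2,3) by auto
  finally show ?thesis .
qed

text \<open>The function \<open>row_of \<sigma>\<close> recovers the whole configuration, which
  turns equality of cosets into equality of configurations.\<close>

lemma dellac_cell_iff:
  assumes C: "C \<in> dellac n" and s: "is_dellac_perm n C \<sigma>"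
  shows "(k, j) \<in> C \<longleftrightarrow> j \<in> {1..2 * n} \<and> k = row_of \<sigma> j"
proof (cases "j \<in> {1..2 * n}")
  case True
  have p: "\<sigma> permutes {1..2 * n}" using s by (simp add: is_dellac_perm_def)
  then have i: "Hilbert_Choice.inv \<sigma> j \<in> {1..2 * n}" "\<sigma> (Hilbert_Choice.inv \<sigma> j) = j"
    using permutes_in_image[OF permutes_inv[OF p]] True permutes_inverses(1)[OF p] by auto
  show ?thesis
  proof (cases "k \<in> {1..n}")
    case k: True
    then show ?thesis using is_dellac_perm_mem_iff[OF s k i(1)] i(2) True by (simp add: row_of_def)
  next
    case False
    then show ?thesis using i C by (auto simp: dellac_def row_of_def)
  qed
next
  case False
  then show ?thesis using C by (auto simp: dellac_def)
qed

lemma dellac_bounded_dellac_perm: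
  assumes C: "C \<in> dellac n" and s: "is_dellac_perm n C \<sigma>"
  shows "dellac_bounded n \<sigma>"
  unfolding dellac_bounded_def
proof
  fix p assume p: "p \<in> {1..2 * n}"
  then have "(p + 1) div 2 \<in> {1..n}" by auto
  then have "((p + 1) div 2, \<sigma> p) \<in> C" using is_dellac_perm_mem_iff[OF s _ p] by blast
  then show "(p + 1) div 2 \<le> \<sigma> p \<and> \<sigma> p \<le> n + (p + 1) div 2" using C by (auto simp: dellac_def)
qed

lemma dellac_of_bounded:
  assumes s: "\<sigma> permutes {1..2 * n}" and b: "dellac_bounded n \<sigma>"
    and o: "\<forall>k\<in>{1..n}. \<sigma> (2 * k - 1) < \<sigma> (2 * k)"
  shows "\<exists>C\<in>dellac n. is_dellac_perm n C \<sigma>"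
proof -
  define C where "C = (\<lambda>p. ((p + 1) div 2, \<sigma> p)) ` {1..2 * n}"
  have inj: "\<sigma> p = \<sigma> q \<longleftrightarrow> p = q" for p q using permutes_inj[OF s] by (auto dest: injD)
  have row: "{j. (k, j) \<in> C} = {\<sigma> (2 * k - 1), \<sigma> (2 * k)}" if "k \<in> {1..n}" for k
  proof
    show "{j. (k, j) \<in> C} \<subseteq> {\<sigma> (2 * k - 1), \<sigma> (2 * k)}"
    proof
      fix j assume "j \<in> {j. (k, j) \<in> C}"
      then obtain p where "p \<in> {1..2 * n}" "k = (p + 1) div 2" "j = \<sigma> p" by (auto simp: C_def)
      moreover from this have "p = 2 * k - 1 \<or> p = 2 * k" by auto
      ultimately show "j \<in> {\<sigma> (2 * k - 1), \<sigma> (2 * k)}" by (metis insertCI)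
    qed
    show "{\<sigma> (2 * k - 1), \<sigma> (2 * k)} \<subseteq> {j. (k, j) \<in> C}"
    proof -
      have "(k, \<sigma> (2 * k - 1)) \<in> C"
        using that unfolding C_def by (intro image_eqI[of _ _ "2 * k - 1"]) auto
      moreover have "(k, \<sigma> (2 * k)) \<in> C"
        using that unfolding C_def by (intro image_eqI[of _ _ "2 * k"]) auto
      ultimately show ?thesis by blast
    qed
  qed
  have "C \<in> dellac n"
    unfolding dellac_def
  proof (intro CollectI conjI ballI)
    show "C \<subseteq> {1..n} \<times> {1..2 * n}"
      unfolding C_def
    proof (intro image_subsetI SigmaI)
      fix p assume p: "p \<in> {1..2 * n}"
      then show "(p + 1) div 2 \<in> {1..n}" by auto
      show "\<sigma> p \<in> {1..2 * n}" using p by (simp only: permutes_in_image[OF s])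
    qed
    have "inj_on (\<lambda>p. ((p + 1) div 2, \<sigma> p)) {1..2 * n}" using inj by (auto intro: inj_onI)
    then show "card C = 2 * n" by (simp add: C_def card_image)
    show "\<exists>!i. (i, j) \<in> C" if "j \<in> {1..2 * n}" for j
    proof (rule ex1I[of _ "row_of \<sigma> j"])
      have "Hilbert_Choice.inv \<sigma> j \<in> {1..2 * n}"
        using that by (simp only: permutes_in_image[OF permutes_inv[OF s]])
      then show "(row_of \<sigma> j, j) \<in> C"
        unfolding C_def row_of_def by (rule rev_image_eqI) (simp add: permutes_inverses(1)[OF s])
      show "i = row_of \<sigma> j" if "(i, j) \<in> C" for i
        using that by (auto simp: C_def row_of_apply[OF permutes_inj[OF s]])
    qed
    show "card {j. (k, j) \<in> C} = 2" if "k \<in> {1..n}" for k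
    proof -
      have "\<sigma> (2 * k - 1) \<noteq> \<sigma> (2 * k)" using bspec[OF o that] by (rule less_imp_neq)
      then show ?thesis unfolding row[OF that] by simp
    qed
    show "case x of (i, j) \<Rightarrow> i \<le> j \<and> j \<le> n + i" if "x \<in> C" for x
      using that b by (auto simp: C_def dellac_bounded_def)
  qed
  moreover have "is_dellac_perm n C \<sigma>"
    unfolding is_dellac_perm_def using s o row by blast
  ultimately show ?thesis by blast
qed

section \<open>Flags between two coordinate subspaces\<close>

lemma row_of_pred: "\<sigma> permutes {1..m} \<Longrightarrow> row_of \<sigma> (\<sigma> (i + 1)) = i div 2 + 1"
  by (simp add: row_of_apply[OF permutes_inj])

text \<open>Reindexing by the values \<open>v = \<sigma> (i + 1)\<close> leaves \<sigma> only inside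
  \<open>row_of \<sigma>\<close>, so the coset depends on nothing else.\<close>

lemma mem_perm_point_iff:
  assumes s: "\<sigma> permutes {1..2 * n}" and n: "1 \<le> n"
  shows "A \<in> perm_point n \<sigma> \<longleftrightarrow> A \<in> carrier (SL (2 * n)) \<and>
    (\<forall>v \<in> {1..2 * n}. \<forall>j < 2 * n. j div 2 + 1 < row_of \<sigma> v \<longrightarrow> A $$ (v - 1, j) = 0)"
proof -
  have "(\<forall>i < 2 * n. \<forall>j < 2 * n. j div 2 < i div 2 \<longrightarrow> A $$ (\<sigma> (i + 1) - 1, j) = 0) \<longleftrightarrow>
    (\<forall>v \<in> {1..2 * n}. \<forall>j < 2 * n. j div 2 + 1 < row_of \<sigma> v \<longrightarrow> A $$ (v - 1, j) = 0)" (is "?L \<longleftrightarrow> ?R")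
  proof
    assume L: ?L
    show ?R
    proof (intro ballI allI impI)
      fix v j assume v: "v \<in> {1..2 * n}" and j: "j < 2 * n" "j div 2 + 1 < row_of \<sigma> v"
      define i where "i = Hilbert_Choice.inv \<sigma> v - 1"
      have "Hilbert_Choice.inv \<sigma> v \<in> {1..2 * n}"
        using v by (simp only: permutes_in_image[OF permutes_inv[OF s]])
      then have i: "i < 2 * n" "Hilbert_Choice.inv \<sigma> v = i + 1" by (auto simp: i_def)
      then have v': "\<sigma> (i + 1) = v" using permutes_inverses(1)[OF s] by metis
      have "j div 2 < i div 2" using j(2) unfolding v'[symmetric] row_of_pred[OF s] by simp
      then show "A $$ (v - 1, j) = 0" using L i(1) j(1) v' by metis
    qed
  next
    assume R: ?R
    show ?L
    proof (intro allI impI)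
      fix i j assume "i < 2 * n" "j < 2 * n" "j div 2 < i div 2"
      moreover from this have "\<sigma> (i + 1) \<in> {1..2 * n}"
        by (subst permutes_in_image[OF s]) simp
      ultimately show "A $$ (\<sigma> (i + 1) - 1, j) = 0"
        using R by (simp only: row_of_pred[OF s] add_less_cancel_right)
    qed
  qed
  then show ?thesis unfolding perm_point_eq[OF s n] by blast
qed

text \<open>Row \<open>v - 1\<close> of the representative is supported in one column, of block
  \<open>row_of \<sigma> v\<close> counted from 1, so there is one inequality per \<open>v\<close>.
  Exchanging the permutations reverses the inequalities.\<close>

lemma weyl_rep_mem_perm_point_iff:
  assumes s: "\<sigma> permutes {1..2 * n}" and r: "\<rho> permutes {1..2 * n}" and n: "1 \<le> n"
  shows "weyl_rep (2 * n) \<sigma> \<in> perm_point n \<rho> \<longleftrightarrow> (\<forall>v \<in> {1..2 * n}. row_of \<rho> v \<le> row_of \<sigma> v)"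
proof -
  have w: "weyl_rep (2 * n) \<sigma> \<in> carrier (SL (2 * n))" using n by (intro weyl_rep_in_SL[OF s]) simp
  have nz: "weyl_rep (2 * n) \<sigma> $$ (v - 1, j) \<noteq> 0 \<longleftrightarrow> v = \<sigma> (j + 1)"
    if "v \<in> {1..2 * n}" "j < 2 * n" for v j
  proof -
    have "v - 1 < 2 * n" "v - 1 + 1 = v" using that(1) by auto
    then show ?thesis using weyl_rep_nonzero_iff[OF s, of "v - 1" j] that(2) by metis
  qed
  show ?thesis
  proof
    assume L: "weyl_rep (2 * n) \<sigma> \<in> perm_point n \<rho>"
    show "\<forall>v \<in> {1..2 * n}. row_of \<rho> v \<le> row_of \<sigma> v"
    proof
      fix v assume v: "v \<in> {1..2 * n}"
      define j where "j = Hilbert_Choice.inv \<sigma> v - 1"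
      have "Hilbert_Choice.inv \<sigma> v \<in> {1..2 * n}"
        using v by (simp only: permutes_in_image[OF permutes_inv[OF s]])
      then have j: "j < 2 * n" "Hilbert_Choice.inv \<sigma> v = j + 1" by (auto simp: j_def)
      then have v': "\<sigma> (j + 1) = v" using permutes_inverses(1)[OF s] by metis
      then have "weyl_rep (2 * n) \<sigma> $$ (v - 1, j) \<noteq> 0" using nz[OF v j(1)] by simp
      then have "\<not> j div 2 + 1 < row_of \<rho> v"
        using L v j(1) unfolding mem_perm_point_iff[OF r n] by blast
      then show "row_of \<rho> v \<le> row_of \<sigma> v" unfolding v'[symmetric] row_of_pred[OF s] by simp
    qed
  next
    assume R: "\<forall>v \<in> {1..2 * n}. row_of \<rho> v \<le> row_of \<sigma> v"
    show "weyl_rep (2 * n) \<sigma> \<in> perm_point n \<rho>"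
      unfolding mem_perm_point_iff[OF r n]
    proof (intro conjI ballI allI impI w)
      fix v j assume v: "v \<in> {1..2 * n}" "j < 2 * n" "j div 2 + 1 < row_of \<rho> v"
      have "v \<noteq> \<sigma> (j + 1)"
      proof
        assume "v = \<sigma> (j + 1)"
        then have "row_of \<sigma> v = j div 2 + 1" using row_of_pred[OF s] by simp
        then show False using R v by fastforce
      qed
      then show "weyl_rep (2 * n) \<sigma> $$ (v - 1, j) = 0" using nz[OF v(1,2)] by blast
    qed
  qed
qed

lemma perm_point_eq_iff:
  assumes s: "\<sigma> permutes {1..2 * n}" and r: "\<rho> permutes {1..2 * n}" and n: "1 \<le> n"
  shows "perm_point n \<sigma> = perm_point n \<rho> \<longleftrightarrow> (\<forall>v \<in> {1..2 * n}. row_of \<sigma> v = row_of \<rho> v)"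
proof
  assume e: "perm_point n \<sigma> = perm_point n \<rho>"
  have "weyl_rep (2 * n) \<sigma> \<in> perm_point n \<rho>" "weyl_rep (2 * n) \<rho> \<in> perm_point n \<sigma>"
    using weyl_rep_mem_perm_point_iff[OF s s n] weyl_rep_mem_perm_point_iff[OF r r n] e by auto
  then show "\<forall>v \<in> {1..2 * n}. row_of \<sigma> v = row_of \<rho> v"
    unfolding weyl_rep_mem_perm_point_iff[OF s r n] weyl_rep_mem_perm_point_iff[OF r s n] by force
next
  assume "\<forall>v \<in> {1..2 * n}. row_of \<sigma> v = row_of \<rho> v"
  then show "perm_point n \<sigma> = perm_point n \<rho>"
    unfolding set_eq_iff mem_perm_point_iff[OF s n] mem_perm_point_iff[OF r n] by auto
qed

section \<open>Translation of cosets and the torus action\<close>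

lemma coset_parabolic_eq:
  assumes "h \<in> g <#\<^bsub>SL (2 * n)\<^esub> parabolic n" "g \<in> carrier (SL (2 * n))"
  shows "h <#\<^bsub>SL (2 * n)\<^esub> parabolic n = g <#\<^bsub>SL (2 * n)\<^esub> parabolic n"
  using group.l_repr_independence[OF group_SL assms subgroup_parabolic] by simp

lemma mem_coset_parabolic:
  "g \<in> carrier (SL (2 * n)) \<Longrightarrow> g \<in> g <#\<^bsub>SL (2 * n)\<^esub> parabolic n"
  by (rule group.lcos_self[OF group_SL _ subgroup_parabolic])

lemma coset_eq_perm_point:
  assumes "\<sigma> permutes {1..2 * n}" "1 \<le> n" "g \<in> perm_point n \<sigma>"
  shows "g <#\<^bsub>SL (2 * n)\<^esub> parabolic n = perm_point n \<sigma>"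
  unfolding perm_point_def
  using assms by (intro coset_parabolic_eq weyl_rep_in_SL) (auto simp: perm_point_def)

lemma translate_coset:
  assumes "g \<in> carrier (SL (2 * n))" "h \<in> carrier (SL (2 * n))"
  shows "g <#\<^bsub>SL (2 * n)\<^esub> (h <#\<^bsub>SL (2 * n)\<^esub> parabolic n) = (g * h) <#\<^bsub>SL (2 * n)\<^esub> parabolic n"
  using group.lcos_m_assoc[OF group_SL _ assms, of "parabolic n"] subgroup.subset[OF subgroup_parabolic] by simp

text \<open>Diagonal matrices rescale rows, and the coset is cut out by vanishing entries.\<close>

lemma torus_fixes_perm_point:
  assumes s: "\<sigma> permutes {1..2 * n}" and n: "1 \<le> n" and t: "t \<in> torus (2 * n)"
  shows "t <#\<^bsub>SL (2 * n)\<^esub> perm_point n \<sigma> = perm_point n \<sigma>"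
proof -
  have t': "t \<in> carrier (SL (2 * n))" "diagonal_mat t" using t by (auto simp: torus_def)
  let ?w = "weyl_rep (2 * n) \<sigma>"
  have w: "?w \<in> carrier (SL (2 * n))" using n by (intro weyl_rep_in_SL[OF s]) simp
  have w': "?w \<in> perm_point n \<sigma>" using weyl_rep_mem_perm_point_iff[OF s s n] by simp
  have "(t * ?w) $$ (v, j) = t $$ (v, v) * ?w $$ (v, j)" if "v < 2 * n" "j < 2 * n" for v j
  proof -
    have "(t * ?w) $$ (v, j) = (\<Sum>k\<in>{v}. t $$ (v, k) * ?w $$ (k, j))"
      unfolding index_mult_SL[OF t'(1) w that]
      using that t' by (intro sum.mono_neutral_right) (auto simp: diagonal_mat_def carrier_SL)
    then show ?thesis by simp
  qed
  then have "t * ?w \<in> perm_point n \<sigma>"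
    using w' mult_in_SL[OF t'(1) w] unfolding mem_perm_point_iff[OF s n] by auto
  then show ?thesis
    using coset_eq_perm_point[OF s n] translate_coset[OF t'(1) w] by (simp add: perm_point_def)
qed

section \<open>The closed conditions on representatives\<close>

lemma weyl_rep_inverse_nonzero_iff:
  assumes s: "\<sigma> permutes {1..m}" and ij: "i < m" "j < m"
  shows "adj_mat (weyl_rep m \<sigma>) $$ (i, j) \<noteq> 0 \<longleftrightarrow> j + 1 = \<sigma> (i + 1)"
proof -
  let ?w = "weyl_rep m \<sigma>"
  have w: "?w \<in> carrier (SL m)" using ij by (intro weyl_rep_in_SL[OF s]) simp
  note p = permutes_pred[OF s ij(1)]
  have "(1\<^sub>m m :: complex mat) $$ (\<sigma> (i + 1) - 1, j) = ?w $$ (\<sigma> (i + 1) - 1, i) * adj_mat ?w $$ (i, j)"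
    using index_weyl_rep_mult[OF s adj_mat_SL(1)[OF w] ij] unfolding adj_mat_SL(2)[OF w] .
  moreover have "?w $$ (\<sigma> (i + 1) - 1, i) \<noteq> 0"
    using weyl_rep_nonzero_iff[OF s p(1) ij(1)] p(2) by simp
  ultimately have "adj_mat ?w $$ (i, j) \<noteq> 0 \<longleftrightarrow> \<sigma> (i + 1) - 1 = j"
    using p(1) ij(2) by (auto split: if_splits)
  also have "\<dots> \<longleftrightarrow> j + 1 = \<sigma> (i + 1)" using p by auto
  finally show ?thesis .
qed

text \<open>The representatives \<open>g\<close> of the flags with members \<open>V\<^sub>2\<^sub>k\<close> such that
  \<open>\<langle>e\<^sub>1, \<dots>, e\<^sub>k\<rangle> \<subseteq> V\<^sub>2\<^sub>k \<subseteq> \<langle>e\<^sub>1, \<dots>, e\<^bsub>n+k\<^esub>\<rangle>\<close>; the first inclusion is expressed by the entries of the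
  inverse of \<open>g\<close>.\<close>

definition flag_bounded :: "nat \<Rightarrow> complex mat set" where
  "flag_bounded n = {g \<in> carrier (SL (2 * n)). \<forall>i < 2 * n. \<forall>j < 2 * n.
     (n + 1 + j div 2 \<le> i \<longrightarrow> g $$ (i, j) = 0) \<and> (i < j div 2 \<longrightarrow> adj_mat g $$ (j, i) = 0)}"

text \<open>A monomial matrix and its inverse have transposed zero patterns, so both families of
  conditions concern the positions \<open>i + 1 = \<sigma> (j + 1)\<close>; the matrix gives the
  upper bound and the inverse the lower one.\<close>

lemma weyl_rep_flag_bounded_iff:
  assumes s: "\<sigma> permutes {1..2 * n}" and n: "1 \<le> n"
  shows "weyl_rep (2 * n) \<sigma> \<in> flag_bounded n \<longleftrightarrow> dellac_bounded n \<sigma>"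
proof -
  let ?w = "weyl_rep (2 * n) \<sigma>"
  have w: "?w \<in> carrier (SL (2 * n))" using n by (intro weyl_rep_in_SL[OF s]) simp
  have "((n + 1 + j div 2 \<le> i \<longrightarrow> ?w $$ (i, j) = 0) \<and> (i < j div 2 \<longrightarrow> adj_mat ?w $$ (j, i) = 0)) \<longleftrightarrow>
      (i + 1 = \<sigma> (j + 1) \<longrightarrow> j div 2 \<le> i \<and> i < n + 1 + j div 2)"
    if "i < 2 * n" "j < 2 * n" for i j
    using weyl_rep_nonzero_iff[OF s that] weyl_rep_inverse_nonzero_iff[OF s that(2,1)] by (meson leD leI)
  then have "?w \<in> flag_bounded n \<longleftrightarrow>
      (\<forall>i < 2 * n. \<forall>j < 2 * n. i + 1 = \<sigma> (j + 1) \<longrightarrow> j div 2 \<le> i \<and> i < n + 1 + j div 2)"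
    unfolding flag_bounded_def using w by simp
  also have "\<dots> \<longleftrightarrow> (\<forall>j < 2 * n. j div 2 + 1 \<le> \<sigma> (j + 1) \<and> \<sigma> (j + 1) \<le> n + (j div 2 + 1))" (is "?L \<longleftrightarrow> ?R")
  proof
    assume L: ?L
    show ?R
    proof (intro allI impI)
      fix j assume j: "j < 2 * n"
      note p = permutes_pred[OF s j]
      show "j div 2 + 1 \<le> \<sigma> (j + 1) \<and> \<sigma> (j + 1) \<le> n + (j div 2 + 1)"
        using L[rule_format, OF p(1) j p(2)] p by linarith
    qed
  qed fastforce
  also have "\<dots> \<longleftrightarrow> dellac_bounded n \<sigma>"
  proof
    assume R: ?R
    show "dellac_bounded n \<sigma>"
      unfolding dellac_bounded_def
    proof
      fix p assume "p \<in> {1..2 * n}"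
      then have "p - 1 < 2 * n" "p - 1 + 1 = p" "(p - 1) div 2 + 1 = (p + 1) div 2" by auto
      then show "(p + 1) div 2 \<le> \<sigma> p \<and> \<sigma> p \<le> n + (p + 1) div 2" using R by metis
    qed
  next
    assume D: "dellac_bounded n \<sigma>"
    show ?R
    proof (intro allI impI)
      fix j assume "j < 2 * n"
      then have "j + 1 \<in> {1..2 * n}" "(j + 1 + 1) div 2 = j div 2 + 1" by auto
      then show "j div 2 + 1 \<le> \<sigma> (j + 1) \<and> \<sigma> (j + 1) \<le> n + (j div 2 + 1)"
        using D unfolding dellac_bounded_def by metis
    qed
  qed
  finally show ?thesis .
qed

lemma adj_mat_mult_SL:
  assumes "g \<in> carrier (SL m)" "h \<in> carrier (SL m)"
  shows "adj_mat (g * h) = adj_mat h * adj_mat g"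
  using group.inv_mult_group[OF group_SL assms] assms by (simp add: inv_SL mult_in_SL)

text \<open>The conditions see \<open>j\<close> only through its block. Vanishing of
  \<open>g\<close> passes to earlier blocks and that of the inverse to later ones, which fits block
  triangularity.\<close>

lemma flag_bounded_mult_parabolic:
  assumes g: "g \<in> flag_bounded n" and p: "p \<in> parabolic n"
  shows "g * p \<in> flag_bounded n"
proof -
  have g': "g \<in> carrier (SL (2 * n))" using g by (simp add: flag_bounded_def)
  have p': "p \<in> carrier (SL (2 * n))" using p by (simp add: parabolic_def)
  have q: "adj_mat p \<in> parabolic n"
    using subgroup.m_inv_closed[OF subgroup_parabolic p] by (simp add: inv_SL[OF p'])
  have "(g * p) $$ (i, j) = 0" if "i < 2 * n" "j < 2 * n" "n + 1 + j div 2 \<le> i" for i j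
    unfolding index_mult_SL[OF g' p' that(1,2)]
  proof (rule sum.neutral, rule ballI)
    fix k assume k: "k \<in> {..<2 * n}"
    show "g $$ (i, k) * p $$ (k, j) = 0"
    proof (cases "j div 2 < k div 2")
      case True
      then show ?thesis using p k that(2) by (simp add: parabolic_def)
    next
      case False
      then have "n + 1 + k div 2 \<le> i" using that(3) by simp
      then show ?thesis using g k that(1) by (simp add: flag_bounded_def)
    qed
  qed
  moreover have "adj_mat (g * p) $$ (j, i) = 0" if "i < 2 * n" "j < 2 * n" "i < j div 2" for i j
    unfolding adj_mat_mult_SL[OF g' p'] index_mult_SL[OF adj_mat_SL(1)[OF p'] adj_mat_SL(1)[OF g'] that(2,1)]
  proof (rule sum.neutral, rule ballI)
    fix k assume k: "k \<in> {..<2 * n}"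
    show "adj_mat p $$ (j, k) * adj_mat g $$ (k, i) = 0"
    proof (cases "k div 2 < j div 2")
      case True
      then show ?thesis using q k that(2) by (simp add: parabolic_def)
    next
      case False
      then have "i < k div 2" using that(3) by simp
      then show ?thesis using g k that(1) by (simp add: flag_bounded_def)
    qed
  qed
  ultimately show ?thesis using mult_in_SL[OF g' p'] by (simp add: flag_bounded_def)
qed

text \<open>Upper triangular matrices preserve initial spans: in entries, vanishing of
  \<open>g\<close> passes to larger \<open>i\<close> and that of the inverse to smaller
  \<open>i\<close>.\<close>

lemma flag_bounded_borel_mult:
  assumes b: "b \<in> borel_subgroup (2 * n)" and g: "g \<in> flag_bounded n"
  shows "b * g \<in> flag_bounded n"
proof -
  have g': "g \<in> carrier (SL (2 * n))" using g by (simp add: flag_bounded_def)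
  have b': "b \<in> carrier (SL (2 * n))" using b by (simp add: borel_subgroup_def)
  have "adj_mat b \<in> borel_subgroup (2 * n)"
    using subgroup.m_inv_closed[OF subgroup_borel b] by (simp add: inv_SL[OF b'])
  then have upper: "b $$ (i, k) = 0" "adj_mat b $$ (i, k) = 0" if "k < i" "i < 2 * n" for i k
    using b that adj_mat_SL(1)[OF b'] by (auto simp: borel_subgroup_def carrier_SL)
  have "(b * g) $$ (i, j) = 0" if "i < 2 * n" "j < 2 * n" "n + 1 + j div 2 \<le> i" for i j
    unfolding index_mult_SL[OF b' g' that(1,2)]
  proof (rule sum.neutral, rule ballI)
    fix k assume k: "k \<in> {..<2 * n}"
    show "b $$ (i, k) * g $$ (k, j) = 0"
      using upper[of k i] g that k by (cases "k < i") (auto simp: flag_bounded_def)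
  qed
  moreover have "adj_mat (b * g) $$ (j, i) = 0" if "i < 2 * n" "j < 2 * n" "i < j div 2" for i j
    unfolding adj_mat_mult_SL[OF b' g'] index_mult_SL[OF adj_mat_SL(1)[OF g'] adj_mat_SL(1)[OF b'] that(2,1)]
  proof (rule sum.neutral, rule ballI)
    fix k assume k: "k \<in> {..<2 * n}"
    show "adj_mat g $$ (j, k) * adj_mat b $$ (k, i) = 0"
      using upper[of i k] g that k by (cases "i < k") (auto simp: flag_bounded_def)
  qed
  ultimately show ?thesis using mult_in_SL[OF b' g'] by (simp add: flag_bounded_def)
qed

lemma openin_not_flag_bounded: "openin (zariski_SL (2 * n)) (carrier (SL (2 * n)) - flag_bounded n)"
proof (subst openin_subopen, rule ballI)
  let ?m = "2 * n"
  fix g assume g: "g \<in> carrier (SL ?m) - flag_bounded n"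
  then obtain i j where ij: "i < ?m" "j < ?m" and
    c: "n + 1 + j div 2 \<le> i \<and> g $$ (i, j) \<noteq> 0 \<or> i < j div 2 \<and> adj_mat g $$ (j, i) \<noteq> 0"
    unfolding flag_bounded_def by blast
  obtain f where f: "f \<in> polynomial_functions ?m" "\<forall>A\<in>carrier (SL ?m). adj_mat A $$ (j, i) = f A"
    using polynomial_function_adj[OF ij(2,1)] by blast
  obtain h where h: "h \<in> polynomial_functions ?m" "h g \<noteq> 0"
    "{A \<in> carrier (SL ?m). h A \<noteq> 0} \<subseteq> carrier (SL ?m) - flag_bounded n"
  proof (cases "n + 1 + j div 2 \<le> i \<and> g $$ (i, j) \<noteq> 0")
    case True
    then show ?thesis
      using ij by (intro that[of "\<lambda>A. A $$ (i, j)"] polynomial_functions.entry) (auto simp: flag_bounded_def)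
  next
    case False
    then have "i < j div 2 \<and> adj_mat g $$ (j, i) \<noteq> 0" using c by blast
    then show ?thesis
      using ij f g by (intro that[of f]) (auto simp: flag_bounded_def)
  qed
  show "\<exists>T. openin (zariski_SL ?m) T \<and> g \<in> T \<and> T \<subseteq> carrier (SL ?m) - flag_bounded n"
    using openin_zariski_basic[OF h(1)] h(2,3) g
    by (intro exI[of _ "{A \<in> carrier (SL ?m). h A \<noteq> 0}"]) auto
qed

lemma schubert_variety_subset_flag_bounded:
  assumes n: "1 \<le> n"
  shows "schubert_variety n (tau n) \<subseteq> (\<lambda>g. g <#\<^bsub>SL (2 * n)\<^esub> parabolic n) ` flag_bounded n"
    (is "_ \<subseteq> ?T")
  unfolding schubert_variety_def
proof (rule closure_of_minimal)
  let ?w = "weyl_rep (2 * n) (tau n)"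
  have w: "?w \<in> carrier (SL (2 * n))" using n by (intro weyl_rep_in_SL tau_permutes) simp
  have wK: "?w \<in> flag_bounded n"
    using weyl_rep_flag_bounded_iff[OF tau_permutes n] dellac_bounded_tau by simp
  show "{b <#\<^bsub>SL (2 * n)\<^esub> perm_point n (tau n) | b. b \<in> borel_subgroup (2 * n)} \<subseteq> ?T"
  proof clarify
    fix b assume b: "b \<in> borel_subgroup (2 * n)"
    then have "b <#\<^bsub>SL (2 * n)\<^esub> perm_point n (tau n) = (b * ?w) <#\<^bsub>SL (2 * n)\<^esub> parabolic n"
      unfolding perm_point_def by (intro translate_coset w) (simp add: borel_subgroup_def)
    then show "b <#\<^bsub>SL (2 * n)\<^esub> perm_point n (tau n) \<in> ?T"
      using flag_bounded_borel_mult[OF b wK] by blast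
  qed
  \<comment> \<open>The quotient topology tests the preimage in the group. As
    \<open>flag_bounded n\<close> is a union of cosets of \<open>P\<close>, it is the full preimage
    of its image.\<close>
  have "g \<in> flag_bounded n" if g: "g \<in> carrier (SL (2 * n))" "g <#\<^bsub>SL (2 * n)\<^esub> parabolic n \<in> ?T" for g
  proof -
    obtain h where h: "h \<in> flag_bounded n" "g <#\<^bsub>SL (2 * n)\<^esub> parabolic n = h <#\<^bsub>SL (2 * n)\<^esub> parabolic n"
      using g(2) by blast
    then have "g \<in> h <#\<^bsub>SL (2 * n)\<^esub> parabolic n" using mem_coset_parabolic[OF g(1)] by simp
    then show ?thesis using flag_bounded_mult_parabolic[OF h(1)] by (auto simp: l_coset_def)
  qed
  then have "{g \<in> carrier (SL (2 * n)). g <#\<^bsub>SL (2 * n)\<^esub> parabolic n \<in> flag_variety n - ?T}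
      = carrier (SL (2 * n)) - flag_bounded n"
    by (auto simp: flag_variety_def LCOSETS_def)
  then have "openin (zariski_flag n) (flag_variety n - ?T)"
    using openin_not_flag_bounded[of n] by (simp add: openin_zariski_flag)
  moreover have "?T \<subseteq> flag_variety n"
    by (auto simp: flag_variety_def LCOSETS_def flag_bounded_def)
  ultimately show "closedin (zariski_flag n) ?T"
    by (simp add: closedin_def topspace_zariski_flag)
qed

section \<open>Degenerations inside the Schubert variety\<close>

text \<open>The Zariski closure of the double coset of \<open>tau n\<close> in the group, through
  its vanishing ideal, so that translations and limits are checked on one polynomial at a
  time.\<close>

definition zariski_hull :: "nat \<Rightarrow> complex mat set" where
  "zariski_hull n = {g \<in> carrier (SL (2 * n)). \<forall>f \<in> polynomial_functions (2 * n).
     (\<forall>b \<in> borel_subgroup (2 * n). \<forall>x \<in> perm_point n (tau n). f (b * x) = 0) \<longrightarrow> f g = 0}"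

lemma perm_point_subset_SL:
  "\<sigma> permutes {1..2 * n} \<Longrightarrow> 1 \<le> n \<Longrightarrow> perm_point n \<sigma> \<subseteq> carrier (SL (2 * n))"
  by (auto simp: mem_perm_point_iff)

lemma perm_point_mult_parabolic:
  assumes s: "\<sigma> permutes {1..2 * n}" and n: "1 \<le> n" and x: "x \<in> perm_point n \<sigma>" and p: "p \<in> parabolic n"
  shows "x * p \<in> perm_point n \<sigma>"
proof -
  have "x * p \<in> x <#\<^bsub>SL (2 * n)\<^esub> parabolic n" using p by (auto simp: l_coset_def)
  then show ?thesis using coset_eq_perm_point[OF s n x] by simp
qed

text \<open>A neighbourhood in the quotient pulls back to an open set containing some
  \<open>f \<noteq> 0\<close> around \<open>g\<close>; by membership in the hull, such an
  \<open>f\<close> is nonzero somewhere on the double coset.\<close>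

lemma zariski_hull_schubert:
  assumes n: "1 \<le> n" and g: "g \<in> zariski_hull n"
  shows "g <#\<^bsub>SL (2 * n)\<^esub> parabolic n \<in> schubert_variety n (tau n)"
  unfolding schubert_variety_def in_closure_of topspace_zariski_flag
proof (intro conjI allI impI)
  have g': "g \<in> carrier (SL (2 * n))" using g by (simp add: zariski_hull_def)
  then show "g <#\<^bsub>SL (2 * n)\<^esub> parabolic n \<in> flag_variety n"
    by (auto simp: flag_variety_def LCOSETS_def)
  fix T assume T: "g <#\<^bsub>SL (2 * n)\<^esub> parabolic n \<in> T \<and> openin (zariski_flag n) T"
  then have "openin (zariski_SL (2 * n)) {g \<in> carrier (SL (2 * n)). g <#\<^bsub>SL (2 * n)\<^esub> parabolic n \<in> T}"
    by (simp add: openin_zariski_flag)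
  then obtain f where f: "f \<in> polynomial_functions (2 * n)" "f g \<noteq> 0"
    "{A \<in> carrier (SL (2 * n)). f A \<noteq> 0} \<subseteq> {g \<in> carrier (SL (2 * n)). g <#\<^bsub>SL (2 * n)\<^esub> parabolic n \<in> T}"
    by (rule openin_zariski_obtains_basic[of _ _ g]) (use g' T in auto)
  then obtain b x where bx: "b \<in> borel_subgroup (2 * n)" "x \<in> perm_point n (tau n)" "f (b * x) \<noteq> 0"
    using g unfolding zariski_hull_def by blast
  have SL: "b \<in> carrier (SL (2 * n))" "x \<in> carrier (SL (2 * n))"
    using bx perm_point_subset_SL[OF tau_permutes n] by (auto simp: borel_subgroup_def)
  have "(b * x) <#\<^bsub>SL (2 * n)\<^esub> parabolic n \<in> T" using f(3) bx(3) mult_in_SL[OF SL] by blast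
  then have "b <#\<^bsub>SL (2 * n)\<^esub> perm_point n (tau n) \<in> T"
    unfolding translate_coset[OF SL, symmetric] coset_eq_perm_point[OF tau_permutes n bx(2)] .
  then show "\<exists>y. y \<in> {b <#\<^bsub>SL (2 * n)\<^esub> perm_point n (tau n) |b. b \<in> borel_subgroup (2 * n)} \<and> y \<in> T"
    using bx(1) by blast
qed

text \<open>Composing \<open>f\<close> with the translation preserves vanishing on the double coset.
  This lets one degeneration start where another has ended.\<close>

lemma zariski_hull_translate:
  assumes n: "1 \<le> n" and g: "g \<in> zariski_hull n" and u: "u \<in> borel_subgroup (2 * n)" and p: "p \<in> parabolic n"
  shows "u * g * p \<in> zariski_hull n"
proof -
  let ?m = "2 * n"
  have SL: "g \<in> carrier (SL ?m)" "u \<in> carrier (SL ?m)" "p \<in> carrier (SL ?m)"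
    using g u p by (auto simp: zariski_hull_def borel_subgroup_def parabolic_def)
  have "f (u * g * p) = 0" if f: "f \<in> polynomial_functions ?m"
    "\<forall>b \<in> borel_subgroup ?m. \<forall>x \<in> perm_point n (tau n). f (b * x) = 0" for f
  proof -
    obtain h where h: "h \<in> polynomial_functions ?m" "\<forall>A\<in>carrier (SL ?m). f (u * A * p) = h A"
      using polynomial_function_translate[OF f(1) SL(2,3)] by blast
    have "h (b * x) = 0" if b: "b \<in> borel_subgroup ?m" and x: "x \<in> perm_point n (tau n)" for b x
    proof -
      have SL': "b \<in> carrier (SL ?m)" "x \<in> carrier (SL ?m)"
        using b x perm_point_subset_SL[OF tau_permutes n] by (auto simp: borel_subgroup_def)
      have "u * (b * x) * p = (u * b) * (x * p)"
        using SL SL' by (simp add: assoc_SL[of _ ?m] mult_in_SL)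
      moreover have "u * b \<in> borel_subgroup ?m"
        using subgroup.m_closed[OF subgroup_borel u b] by simp
      moreover have "x * p \<in> perm_point n (tau n)" by (rule perm_point_mult_parabolic[OF tau_permutes n x p])
      ultimately have "f (u * (b * x) * p) = 0" using f(2) by simp
      then show ?thesis using h(2) mult_in_SL[OF SL'] by simp
    qed
    then have "h g = 0" using g h(1) by (simp add: zariski_hull_def)
    then show ?thesis using h(2) SL(1) by simp
  qed
  then show ?thesis using SL by (auto simp: zariski_hull_def mult_in_SL)
qed

text \<open>A polynomial in \<open>s\<close> that vanishes for all \<open>s \<noteq> 0\<close> has
  infinitely many roots, so it vanishes at 0 as well.\<close>

lemma zariski_hull_limit:
  assumes A: "A \<in> carrier (SL (2 * n))" and kl: "k < 2 * n" "l < 2 * n"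
    and lim: "\<And>s. s \<noteq> 0 \<Longrightarrow> addrow s k l A \<in> zariski_hull n"
  shows "A \<in> zariski_hull n"
proof -
  have A': "A \<in> carrier_mat (2 * n) (2 * n)" using A by (simp add: carrier_SL)
  have "f A = 0" if f: "f \<in> polynomial_functions (2 * n)"
    "\<forall>b \<in> borel_subgroup (2 * n). \<forall>x \<in> perm_point n (tau n). f (b * x) = 0" for f
  proof -
    obtain q where q: "\<And>s. f (addrow s k l A) = poly q s"
      using polynomial_function_along_line[OF f(1) A' kl] by blast
    have "poly q s = 0" if "s \<noteq> 0" for s
      using lim[OF that] f unfolding q[symmetric] zariski_hull_def by blast
    then have "UNIV - {0} \<subseteq> {s. poly q s = 0}" by blast
    then have "infinite {s. poly q s = 0}"
      using infinite_UNIV_char_0 by (metis finite_Diff2 finite.emptyI finite.insertI finite_subset)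
    then have "q = 0" using poly_roots_finite by blast
    moreover have "addrow 0 k l A = A"
      using A' kl by (intro eq_matI) (auto simp: mat_addrow_def)
    ultimately show ?thesis using q[of 0] by simp
  qed
  then show ?thesis using A by (auto simp: zariski_hull_def)
qed

lemma addrow_mat_in_borel: "a < c \<Longrightarrow> addrow_mat m s a c \<in> borel_subgroup m"
  using det_addrow_mat[of a c m s] by (auto simp: borel_subgroup_def carrier_SL upper_triangular_def)

text \<open>For \<open>s \<noteq> 0\<close> the point \<open>(1 + s E\<^sub>c\<^sub>a) \<sigma> P\<close> equals \<open>(1 + s\<^sup>-\<^sup>1 E\<^sub>a\<^sub>c) \<sigma>' P\<close>, so it lies in the
  \<open>B\<close>-orbit of \<open>\<sigma>' P\<close>; as \<open>s\<close> tends to \<open>0\<close> it degenerates to \<open>\<sigma> P\<close>.\<close>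

lemma zariski_hull_swap:
  assumes n: "1 \<le> n" and s: "\<sigma> permutes {1..2 * n}"
    and pq: "1 \<le> p" "p < q" "q \<le> 2 * n" "\<sigma> p < \<sigma> q"
    and hull: "weyl_rep (2 * n) (transpose (\<sigma> p) (\<sigma> q) \<circ> \<sigma>) \<in> zariski_hull n"
  shows "weyl_rep (2 * n) \<sigma> \<in> zariski_hull n"
proof -
  let ?m = "2 * n" and ?\<rho> = "transpose (\<sigma> p) (\<sigma> q) \<circ> \<sigma>"
  let ?A = "weyl_rep ?m \<sigma>"
  have img: "\<sigma> p \<in> {1..?m}" "\<sigma> q \<in> {1..?m}"
    using pq by (simp_all only: permutes_in_image[OF s]) auto
  have r: "?\<rho> permutes {1..?m}"
    by (rule permutes_compose[OF s permutes_swap_id[OF img]])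
  define a c where "a = \<sigma> p - 1" and "c = \<sigma> q - 1"
  have ac: "a < c" "c < ?m" "a < ?m" "a + 1 = \<sigma> p" "c + 1 = \<sigma> q"
    using img pq(4) by (auto simp: a_def c_def)
  have A: "?A \<in> carrier (SL ?m)" "weyl_rep ?m ?\<rho> \<in> carrier (SL ?m)"
    using n by (auto intro!: weyl_rep_in_SL s r)
  then have A': "?A \<in> carrier_mat ?m ?m" by (simp add: carrier_SL)
  have A0: "?A $$ (i, j) = 0" if "i < ?m" "j < ?m" "i + 1 \<noteq> \<sigma> (j + 1)" for i j
    using weyl_rep_nonzero_iff[OF s that(1,2)] that(3) by blast
  show ?thesis
  proof (rule zariski_hull_limit[OF A(1) ac(2,3)])
    fix z :: complex assume z: "z \<noteq> 0"
    let ?U = "addrow_mat ?m (1 / z) a c" and ?U' = "addrow_mat ?m (- (1 / z)) a c"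
    define V where "V = addrow z c a ?A"
    have V: "V = addrow_mat ?m z c a * ?A" unfolding V_def by (rule addrow_mat[OF A' ac(3)])
    have "addrow_mat ?m z c a \<in> carrier (SL ?m)"
      using ac by (simp add: carrier_SL det_addrow_mat)
    then have VSL: "V \<in> carrier (SL ?m)" unfolding V by (rule mult_in_SL[OF _ A(1)])
    then have V': "V \<in> carrier_mat ?m ?m" by (simp add: carrier_SL)
    have U: "?U \<in> borel_subgroup ?m" "?U' \<in> borel_subgroup ?m" using ac by (auto intro: addrow_mat_in_borel)
    then have USL: "?U \<in> carrier (SL ?m)" "?U' \<in> carrier (SL ?m)" by (auto simp: borel_subgroup_def)
    define N where "N = ?U' * V"
    have NSL: "N \<in> carrier (SL ?m)" unfolding N_def by (rule mult_in_SL[OF USL(2) VSL])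
    \<comment> \<open>The factor cancels the old row \<open>a\<close>: now row \<open>a\<close> is
      \<open>- (1 / z)\<close> times the old row \<open>c\<close>, and row \<open>c\<close> is
      \<open>z\<close> times the old row \<open>a\<close> plus the old row \<open>c\<close>. Up to
      scaling and the last term the rows are exchanged.\<close>
    have N: "N = addrow (- (1 / z)) a c V" unfolding N_def by (rule addrow_mat[OF V' ac(2), symmetric])
    have Nac: "N $$ (c, j) = z * ?A $$ (a, j) + ?A $$ (c, j)" "N $$ (a, j) = - (1 / z) * ?A $$ (c, j)"
      if "j < ?m" for j
      unfolding N V_def using A' that ac z by (auto simp: mat_addrow_def field_simps)
    have Nij: "N $$ (i, j) = ?A $$ (i, j)" if "i < ?m" "j < ?m" "i \<noteq> a" "i \<noteq> c" for i j
      unfolding N V_def using A' that by (auto simp: mat_addrow_def)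
    \<comment> \<open>The old rows \<open>a\<close> and \<open>c\<close> are supported in columns
      \<open>p - 1\<close> and \<open>q - 1\<close>. As \<open>p < q\<close>, the extra term in the
      new row \<open>c\<close> lies further right and is harmless.\<close>
    have "N \<in> perm_point n ?\<rho>"
      unfolding perm_point_eq[OF r n]
    proof (intro CollectI conjI allI impI NSL)
      fix i j assume ij: "i < ?m" "j < ?m" "j div 2 < i div 2"
      then have "j < i" by (metis div_le_mono leD leI)
      have inj: "\<sigma> x = \<sigma> y \<longleftrightarrow> x = y" for x y using permutes_inj[OF s] by (auto dest: injD)
      consider "i + 1 = p" | "i + 1 = q" | "i + 1 \<noteq> p" "i + 1 \<noteq> q" by blast
      then show "N $$ (?\<rho> (i + 1) - 1, j) = 0"
      proof cases
        case 1
        then have "?\<rho> (i + 1) - 1 = c" by (simp add: c_def)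
        moreover have "?A $$ (a, j) = 0" "?A $$ (c, j) = 0"
          using A0[OF ac(3) ij(2)] A0[OF ac(2) ij(2)] 1 \<open>j < i\<close> pq(2) ac(4,5) inj by auto
        ultimately show ?thesis using Nac(1)[OF ij(2)] by simp
      next
        case 2
        then have "?\<rho> (i + 1) - 1 = a" by (simp add: a_def)
        moreover have "?A $$ (c, j) = 0"
          using A0[OF ac(2) ij(2)] 2 \<open>j < i\<close> ac(5) inj by auto
        ultimately show ?thesis using Nac(2)[OF ij(2)] by simp
      next
        case 3
        then have ne: "\<sigma> (i + 1) \<noteq> \<sigma> p" "\<sigma> (i + 1) \<noteq> \<sigma> q" using inj by auto
        then have e: "?\<rho> (i + 1) = \<sigma> (i + 1)" by simp
        note k = permutes_pred[OF s ij(1)]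
        have "\<sigma> (i + 1) - 1 \<noteq> a" "\<sigma> (i + 1) - 1 \<noteq> c" using ne k(2) ac(4,5) by metis+
        then have "N $$ (\<sigma> (i + 1) - 1, j) = ?A $$ (\<sigma> (i + 1) - 1, j)" by (rule Nij[OF k(1) ij(2)])
        also have "\<dots> = 0" using A0[OF k(1) ij(2)] \<open>j < i\<close> unfolding k(2) inj by simp
        finally show ?thesis unfolding e .
      qed
    qed
    then obtain x where x: "x \<in> parabolic n" "N = weyl_rep ?m ?\<rho> * x"
      by (auto simp: perm_point_def l_coset_def)
    have xSL: "x \<in> carrier (SL ?m)" using x(1) by (simp add: parabolic_def)
    have "V = ?U * ?U' * V"
      using addrow_mat_inv[of a ?m c "1 / z"] ac V' by simp
    also have "\<dots> = ?U * N" unfolding N_def by (rule assoc_SL[OF USL VSL])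
    also have "\<dots> = ?U * weyl_rep ?m ?\<rho> * x" unfolding x(2) by (rule assoc_SL[OF USL(1) A(2) xSL, symmetric])
    finally show "addrow z c a ?A \<in> zariski_hull n"
      using zariski_hull_translate[OF n hull U(1) x(1)] by (simp add: V_def)
  qed
qed

text \<open>Each swap lowers the weighted sum, and membership in the hull comes back along it. Once
  the rows are those of \<open>tau n\<close>, the representative lies in the double coset
  itself.\<close>

lemma weyl_rep_in_zariski_hull:
  assumes n: "1 \<le> n" and "\<sigma> permutes {1..2 * n}" "dellac_bounded n \<sigma>"
  shows "weyl_rep (2 * n) \<sigma> \<in> zariski_hull n"
  using assms(2,3)
proof (induction "\<Sum>k\<in>{1..2 * n}. k * \<sigma> k" arbitrary: \<sigma> rule: less_induct)
  case less
  note s = less.prems(1)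
  show ?case
  proof (cases "\<exists>v\<in>{1..2 * n}. row_of \<sigma> v \<noteq> (if v \<le> n then v else v - n)")
    case True
    from dellac_swap[OF s less.prems(2) True]
    obtain p q where pq: "1 \<le> p" "p < q" "q \<le> 2 * n" "\<sigma> p < \<sigma> q"
      "dellac_bounded n (transpose (\<sigma> p) (\<sigma> q) \<circ> \<sigma>)" by blast
    have "p \<in> {1..2 * n}" "q \<in> {1..2 * n}" using pq by auto
    then have "\<sigma> p \<in> {1..2 * n}" "\<sigma> q \<in> {1..2 * n}" by (simp_all only: permutes_in_image[OF s])
    then have "transpose (\<sigma> p) (\<sigma> q) \<circ> \<sigma> permutes {1..2 * n}"
      by (intro permutes_compose[OF s permutes_swap_id])
    moreover have "(\<Sum>k\<in>{1..2 * n}. k * (transpose (\<sigma> p) (\<sigma> q) \<circ> \<sigma>) k) < (\<Sum>k\<in>{1..2 * n}. k * \<sigma> k)"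
      using pq by (intro weighted_sum_swap permutes_inj[OF s]) auto
    ultimately show ?thesis
      using less.hyps pq by (intro zariski_hull_swap[OF n s pq(1-4)]) blast
  next
    case False
    have "row_of (tau n) v = (if v \<le> n then v else v - n)" if v: "v \<in> {1..2 * n}" for v
    proof (cases "v \<le> n")
      case True
      then show ?thesis
        using row_of_apply[OF permutes_inj[OF tau_permutes], of n "2 * v - 1"] tau_odd[of v n] v by auto
    next
      case False
      then show ?thesis
        using row_of_apply[OF permutes_inj[OF tau_permutes], of n "2 * (v - n)"] tau_even[of "v - n" n] v by auto
    qed
    then have x: "weyl_rep (2 * n) \<sigma> \<in> perm_point n (tau n)"
      unfolding weyl_rep_mem_perm_point_iff[OF s tau_permutes n] using False by auto
    have w: "weyl_rep (2 * n) \<sigma> \<in> carrier (SL (2 * n))" using n by (intro weyl_rep_in_SL[OF s]) simp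
    have "1\<^sub>m (2 * n) \<in> borel_subgroup (2 * n)"
      using subgroup.one_closed[OF subgroup_borel] by simp
    then have "f (1\<^sub>m (2 * n) * weyl_rep (2 * n) \<sigma>) = 0"
      if "\<forall>b \<in> borel_subgroup (2 * n). \<forall>x \<in> perm_point n (tau n). f (b * x) = 0"
      for f :: "complex mat \<Rightarrow> complex"
      using that x by blast
    then show ?thesis using w by (simp add: zariski_hull_def one_mult_SL[OF w])
  qed
qed

section \<open>Torus fixed cosets are coordinate flags\<close>

text \<open>Being fixed by \<open>t\<close> puts \<open>adj_mat g * t * g\<close> into
  \<open>P\<close>. Its entry \<open>(p, q)\<close> is a linear form in the diagonal of
  \<open>t\<close> whose coefficients are these products, and it vanishes for every diagonal of
  determinant one.\<close>

lemma torus_fixed_coset_entries: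
  assumes g: "g \<in> carrier (SL (2 * n))"
    and fixed: "\<And>t. t \<in> torus (2 * n) \<Longrightarrow>
      t <#\<^bsub>SL (2 * n)\<^esub> (g <#\<^bsub>SL (2 * n)\<^esub> parabolic n) = g <#\<^bsub>SL (2 * n)\<^esub> parabolic n"
    and pq: "p < 2 * n" "q < 2 * n" "q div 2 < p div 2" and i: "i < 2 * n"
  shows "adj_mat g $$ (p, i) * g $$ (i, q) = 0"
proof -
  let ?m = "2 * n"
  define x where "x = (\<lambda>i. adj_mat g $$ (p, i) * g $$ (i, q))"
  have adj: "adj_mat g \<in> carrier (SL ?m)" by (rule adj_mat_SL[OF g])
  have sum0: "(\<Sum>i<?m. d i * x i) = 0" if d: "(\<Prod>i<?m. d i) = 1" for d :: "nat \<Rightarrow> complex"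
  proof -
    define t where "t = mat ?m ?m (\<lambda>(i, j). if i = j then d i else 0)"
    have tc: "t \<in> carrier_mat ?m ?m" by (simp add: t_def)
    have "upper_triangular t" by (auto simp: t_def)
    then have "det t = prod_list (diag_mat t)" by (rule det_upper_triangular[OF _ tc])
    also have "\<dots> = (\<Prod>i<?m. d i)"
      unfolding prod_list_diag_prod using tc by (auto simp: t_def atLeast0LessThan intro!: prod.cong)
    finally have t: "t \<in> carrier (SL ?m)" using d tc by (simp add: carrier_SL)
    have "t \<in> torus ?m" using t by (auto simp: torus_def diagonal_mat_def t_def)
    from fixed[OF this] have "(t * g) <#\<^bsub>SL ?m\<^esub> parabolic n = g <#\<^bsub>SL ?m\<^esub> parabolic n"
      unfolding translate_coset[OF t g] .
    then have "t * g \<in> g <#\<^bsub>SL ?m\<^esub> parabolic n"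
      using mem_coset_parabolic[OF mult_in_SL[OF t g]] by simp
    then obtain h where h: "h \<in> parabolic n" "t * g = g * h" by (auto simp: l_coset_def)
    have hSL: "h \<in> carrier (SL ?m)" using h(1) by (simp add: parabolic_def)
    have "adj_mat g * (t * g) = h"
      unfolding h(2) using assoc_SL[OF adj g hSL] adj_mat_SL(3)[OF g] one_mult_SL[OF hSL] by simp
    then have "(adj_mat g * (t * g)) $$ (p, q) = 0"
      using h(1) pq by (simp add: parabolic_def)
    moreover have "(t * g) $$ (i, q) = d i * g $$ (i, q)" if "i < ?m" for i
    proof -
      have "(t * g) $$ (i, q) = (\<Sum>k\<in>{i}. t $$ (i, k) * g $$ (k, q))"
        unfolding index_mult_SL[OF t g that pq(2)]
        using that by (intro sum.mono_neutral_right) (auto simp: t_def)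
      then show ?thesis using that by (simp add: t_def)
    qed
    ultimately show ?thesis
      unfolding index_mult_SL[OF adj mult_in_SL[OF t g] pq(1,2)] by (simp add: x_def mult_ac)
  qed
  have total: "(\<Sum>i<?m. x i) = 0" using sum0[of "\<lambda>_. 1"] by simp
  \<comment> \<open>The diagonal with 2 at \<open>i\<close>, 1/2 at \<open>j\<close> and 1 elsewhere
    is compared with the identity. Used in both directions, the relation gives
    \<open>x i = x i / 4\<close>.\<close>
  have half: "x i = x j / 2" if ij: "i < ?m" "j < ?m" "i \<noteq> j" for i j
  proof -
    define d where "d = (\<lambda>k. if k = i then 2 else if k = j then 1 / 2 else (1 :: complex))"
    have "(\<Prod>k<?m. d k) = d i * (d j * (\<Prod>k\<in>{..<?m} - {i} - {j}. d k))"
      using ij prod.remove[of "{..<?m}" i d] prod.remove[of "{..<?m} - {i}" j d] by simp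
    also have "(\<Prod>k\<in>{..<?m} - {i} - {j}. d k) = 1" by (rule prod.neutral) (simp add: d_def)
    finally have "(\<Prod>k<?m. d k) = 1" using ij by (simp add: d_def)
    then have "0 = (\<Sum>k<?m. d k * x k) - (\<Sum>k<?m. x k)" using sum0 total by simp
    also have "\<dots> = (\<Sum>k<?m. (d k - 1) * x k)" by (simp add: sum_subtractf algebra_simps)
    also have "\<dots> = (\<Sum>k\<in>{i, j}. (d k - 1) * x k)"
      using ij by (intro sum.mono_neutral_right) (auto simp: d_def)
    also have "\<dots> = x i - x j / 2" using ij by (simp add: d_def)
    finally show ?thesis by simp
  qed
  obtain j where j: "j < ?m" "i \<noteq> j"
  proof -
    have "p \<noteq> q" using pq(3) by auto
    then show ?thesis using that[of p] that[of q] pq by metis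
  qed
  have "x i = x i / 2 / 2" using half[OF i j] half[OF j(1) i] j(2) by simp
  then have "x i = 0" by simp
  then show ?thesis by (simp add: x_def)
qed

text \<open>The block of \<open>i\<close> is the first one in which row \<open>i\<close> of
  \<open>g\<close> is nonzero; a trace shows that each block occurs exactly twice.\<close>

lemma torus_fixed_coset_eq_perm_point:
  assumes n: "1 \<le> n" and g: "g \<in> carrier (SL (2 * n))"
    and fixed: "\<And>t. t \<in> torus (2 * n) \<Longrightarrow>
      t <#\<^bsub>SL (2 * n)\<^esub> (g <#\<^bsub>SL (2 * n)\<^esub> parabolic n) = g <#\<^bsub>SL (2 * n)\<^esub> parabolic n"
  shows "\<exists>\<sigma>. \<sigma> permutes {1..2 * n} \<and> (\<forall>k\<in>{1..n}. \<sigma> (2 * k - 1) < \<sigma> (2 * k)) \<and>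
    g <#\<^bsub>SL (2 * n)\<^esub> parabolic n = perm_point n \<sigma>"
proof -
  let ?m = "2 * n"
  have adj: "adj_mat g \<in> carrier (SL ?m)" by (rule adj_mat_SL[OF g])
  note zero = torus_fixed_coset_entries[OF g fixed]
  have ex: "\<exists>k. \<exists>q<?m. q div 2 = k \<and> g $$ (i, q) \<noteq> 0" if i: "i < ?m" for i
  proof (rule ccontr)
    assume "\<nexists>k. \<exists>q<?m. q div 2 = k \<and> g $$ (i, q) \<noteq> 0"
    then have "(g * adj_mat g) $$ (i, i) = 0"
      unfolding index_mult_SL[OF g adj i i] by (intro sum.neutral) auto
    then show False unfolding adj_mat_SL(2)[OF g] using i by simp
  qed
  define r where "r = (\<lambda>i. LEAST k. \<exists>q<?m. q div 2 = k \<and> g $$ (i, q) \<noteq> 0)"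
  have r_le: "r i \<le> q div 2" if "q < ?m" "g $$ (i, q) \<noteq> 0" for i q
    unfolding r_def using that by (intro Least_le) blast
  have r_ex: "\<exists>q<?m. q div 2 = r i \<and> g $$ (i, q) \<noteq> 0" if "i < ?m" for i
    unfolding r_def by (rule LeastI_ex[OF ex[OF that]])
  have adj0: "adj_mat g $$ (q, i) = 0" if iq: "i < ?m" "q < ?m" "r i < q div 2" for i q
  proof -
    obtain q' where "q' < ?m" "q' div 2 = r i" "g $$ (i, q') \<noteq> 0" using r_ex[OF iq(1)] by blast
    then show ?thesis using zero[OF _ iq(2) _ _ iq(1), of q'] iq(3) by simp
  qed
  have card: "card {i. i < ?m \<and> r i = k} = 2" if k: "k < n" for k
  proof -
    define I where "I = {q. q < ?m \<and> q div 2 = k}"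
    have I: "I = {2 * k, 2 * k + 1}" using k by (auto simp: I_def)
    \<comment> \<open>These are diagonal entries of the projection to block \<open>k\<close>,
      conjugated by \<open>g\<close>. Before block \<open>r i\<close> the entries of
      \<open>g\<close> vanish and after it those of the inverse, so each is 0 or 1.\<close>
    have block: "(\<Sum>q\<in>I. g $$ (i, q) * adj_mat g $$ (q, i)) = (if r i = k then 1 else 0)" if i: "i < ?m" for i
    proof (cases "r i = k")
      case True
      have "1 = (g * adj_mat g) $$ (i, i)" unfolding adj_mat_SL(2)[OF g] using i by simp
      also have "\<dots> = (\<Sum>q\<in>I. g $$ (i, q) * adj_mat g $$ (q, i))"
        unfolding index_mult_SL[OF g adj i i]
      proof (rule sum.mono_neutral_right)
        show "\<forall>q\<in>{..<?m} - I. g $$ (i, q) * adj_mat g $$ (q, i) = 0"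
        proof
          fix q assume "q \<in> {..<?m} - I"
          then have "q < ?m" "q div 2 < r i \<or> r i < q div 2" using True by (auto simp: I_def)
          then show "g $$ (i, q) * adj_mat g $$ (q, i) = 0"
            using r_le[of q i] adj0[OF i, of q] by force
        qed
      qed (auto simp: I_def)
      finally show ?thesis using True by simp
    next
      case False
      have "g $$ (i, q) * adj_mat g $$ (q, i) = 0" if "q \<in> I" for q
        using that False r_le[of q i] adj0[OF i, of q] by (force simp: I_def)
      then have "(\<Sum>q\<in>I. g $$ (i, q) * adj_mat g $$ (q, i)) = 0" by (intro sum.neutral ballI)
      then show ?thesis using False by simp
    qed
    \<comment> \<open>The trace of that projection is the block size 2, and it counts the indices
      with \<open>r i = k\<close>.\<close>
    have "(2 :: complex) = (\<Sum>q\<in>I. (adj_mat g * g) $$ (q, q))"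
      unfolding adj_mat_SL(3)[OF g] I using k by simp
    also have "\<dots> = (\<Sum>q\<in>I. \<Sum>i<?m. adj_mat g $$ (q, i) * g $$ (i, q))"
      by (intro sum.cong index_mult_SL[OF adj g]) (auto simp: I_def)
    also have "\<dots> = (\<Sum>i<?m. \<Sum>q\<in>I. g $$ (i, q) * adj_mat g $$ (q, i))"
      by (subst sum.swap) (simp add: mult.commute)
    also have "\<dots> = (\<Sum>i<?m. if r i = k then 1 else 0)"
      using block by (intro sum.cong) auto
    also have "\<dots> = of_nat (card {i. i < ?m \<and> r i = k})"
      by (simp add: sum.If_cases Int_def)
    finally show ?thesis by (metis of_nat_eq_iff of_nat_numeral)
  qed
  \<comment> \<open>Blocks and matrix indices count from 0, rows and columns of configurations from
    1.\<close>
  define R where "R = (\<lambda>k. Suc ` {i. i < ?m \<and> r i = k - 1})"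
  have "\<exists>!\<sigma>. \<sigma> permutes {1..?m} \<and>
      (\<forall>k\<in>{1..n}. \<sigma> (2 * k - 1) < \<sigma> (2 * k) \<and> {\<sigma> (2 * k - 1), \<sigma> (2 * k)} = R k)"
  proof (rule ex1_permutation_of_rows)
    show "card (R k) = 2" if "k \<in> {1..n}" for k
    proof -
      have "k - 1 < n" using that by auto
      then show ?thesis using card[of "k - 1"] by (simp add: R_def card_image)
    qed
  qed (auto simp: R_def)
  then obtain \<sigma> where s: "\<sigma> permutes {1..?m}"
    "\<forall>k\<in>{1..n}. \<sigma> (2 * k - 1) < \<sigma> (2 * k) \<and> {\<sigma> (2 * k - 1), \<sigma> (2 * k)} = R k" by blast
  have "g \<in> perm_point n \<sigma>"
    unfolding perm_point_eq[OF s(1) n]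
  proof (intro CollectI conjI allI impI g)
    fix i j assume ij: "i < ?m" "j < ?m" "j div 2 < i div 2"
    let ?k = "i div 2 + 1"
    have "?k \<in> {1..n}" using ij(1) by auto
    then have "{\<sigma> (2 * ?k - 1), \<sigma> (2 * ?k)} = R ?k" using s(2) by blast
    moreover have "i + 1 = 2 * ?k - 1 \<or> i + 1 = 2 * ?k" by presburger
    ultimately have "\<sigma> (i + 1) \<in> R ?k" by (metis insertCI)
    then have "r (\<sigma> (i + 1) - 1) = i div 2" by (auto simp: R_def)
    then show "g $$ (\<sigma> (i + 1) - 1, j) = 0" using r_le[OF ij(2)] ij(3) by (metis leD)
  qed
  then show ?thesis using s coset_eq_perm_point[OF s(1) n] by blast
qed

lemma torus_fixed_points_schubert_tau:
  assumes n: "1 \<le> n"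
  shows "torus_fixed_points n (schubert_variety n (tau n)) = dellac_point n ` dellac n"
proof
  show "torus_fixed_points n (schubert_variety n (tau n)) \<subseteq> dellac_point n ` dellac n"
  proof
    fix x assume x: "x \<in> torus_fixed_points n (schubert_variety n (tau n))"
    then have "x \<in> (\<lambda>g. g <#\<^bsub>SL (2 * n)\<^esub> parabolic n) ` flag_bounded n"
      using schubert_variety_subset_flag_bounded[OF n] by (auto simp: torus_fixed_points_def)
    then obtain g where g: "g \<in> flag_bounded n" "x = g <#\<^bsub>SL (2 * n)\<^esub> parabolic n" by blast
    have gSL: "g \<in> carrier (SL (2 * n))" using g(1) by (simp add: flag_bounded_def)
    obtain \<sigma> where s: "\<sigma> permutes {1..2 * n}" "\<forall>k\<in>{1..n}. \<sigma> (2 * k - 1) < \<sigma> (2 * k)"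
      "x = perm_point n \<sigma>"
      using torus_fixed_coset_eq_perm_point[OF n gSL] x unfolding g(2) torus_fixed_points_def by blast
    \<comment> \<open>The bounds are known for \<open>g\<close>; stability under \<open>P\<close>
      carries them to the permutation representative of the same coset.\<close>
    have "weyl_rep (2 * n) \<sigma> \<in> x"
      unfolding s(3) weyl_rep_mem_perm_point_iff[OF s(1) s(1) n] by simp
    then have "weyl_rep (2 * n) \<sigma> \<in> flag_bounded n"
      using flag_bounded_mult_parabolic[OF g(1)] unfolding g(2) by (auto simp: l_coset_def)
    then have "dellac_bounded n \<sigma>" unfolding weyl_rep_flag_bounded_iff[OF s(1) n] .
    then obtain C where C: "C \<in> dellac n" "is_dellac_perm n C \<sigma>"
      using dellac_of_bounded[OF s(1) _ s(2)] by blast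
    then have "dellac_perm n C = \<sigma>"
      unfolding dellac_perm_def using ex1_dellac_perm[OF C(1)] by (intro the1_equality)
    then show "x \<in> dellac_point n ` dellac n" using C(1) s(3) by (auto simp: dellac_point_def)
  qed
  show "dellac_point n ` dellac n \<subseteq> torus_fixed_points n (schubert_variety n (tau n))"
  proof (rule image_subsetI)
    fix C assume C: "C \<in> dellac n"
    let ?\<sigma> = "dellac_perm n C"
    have p: "is_dellac_perm n C ?\<sigma>" by (rule is_dellac_perm_dellac_perm[OF C])
    then have s: "?\<sigma> permutes {1..2 * n}" by (simp add: is_dellac_perm_def)
    have "weyl_rep (2 * n) ?\<sigma> \<in> zariski_hull n"
      by (rule weyl_rep_in_zariski_hull[OF n s dellac_bounded_dellac_perm[OF C p]])
    then have "perm_point n ?\<sigma> \<in> schubert_variety n (tau n)"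
      unfolding perm_point_def by (rule zariski_hull_schubert[OF n])
    then show "dellac_point n C \<in> torus_fixed_points n (schubert_variety n (tau n))"
      using torus_fixes_perm_point[OF s n] by (simp add: torus_fixed_points_def dellac_point_def)
  qed
qed

lemma inj_on_dellac_point:
  assumes n: "1 \<le> n"
  shows "inj_on (dellac_point n) (dellac n)"
proof (rule inj_onI)
  fix C D assume C: "C \<in> dellac n" and D: "D \<in> dellac n" and e: "dellac_point n C = dellac_point n D"
  note pC = is_dellac_perm_dellac_perm[OF C] and pD = is_dellac_perm_dellac_perm[OF D]
  have "dellac_perm n C permutes {1..2 * n}" "dellac_perm n D permutes {1..2 * n}"
    using pC pD by (auto simp: is_dellac_perm_def)
  from perm_point_eq_iff[OF this n]
  have "\<forall>v\<in>{1..2 * n}. row_of (dellac_perm n C) v = row_of (dellac_perm n D) v"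
    using e by (simp add: dellac_point_def)
  then have "(k, j) \<in> C \<longleftrightarrow> (k, j) \<in> D" for k j
    unfolding dellac_cell_iff[OF C pC] dellac_cell_iff[OF D pD] by auto
  then show "C = D" by auto
qed

lemma finite_dellac: "finite (dellac n)"
  by (rule finite_subset[of _ "Pow ({1..n} \<times> {1..2 * n})"]) (auto simp: dellac_def)

theorem theoremA:
  fixes n :: nat
  assumes "1 \<le> n"
  shows "(\<forall>C \<in> dellac n. \<exists>!\<sigma>. is_dellac_perm n C \<sigma>) \<and>
         bij_betw (dellac_point n) (dellac n)
           (torus_fixed_points n (schubert_variety n (tau n))) \<and>
         finite (torus_fixed_points n (schubert_variety n (tau n))) \<and>
         card (torus_fixed_points n (schubert_variety n (tau n))) = normalized_median_genocchi n"
proof (intro conjI ballI)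
  have fp: "torus_fixed_points n (schubert_variety n (tau n)) = dellac_point n ` dellac n"
    by (rule torus_fixed_points_schubert_tau[OF assms])
  show "\<exists>!\<sigma>. is_dellac_perm n C \<sigma>" if "C \<in> dellac n" for C by (rule ex1_dellac_perm[OF that])
  show "bij_betw (dellac_point n) (dellac n) (torus_fixed_points n (schubert_variety n (tau n)))"
    unfolding fp by (rule inj_on_imp_bij_betw[OF inj_on_dellac_point[OF assms]])
  show "finite (torus_fixed_points n (schubert_variety n (tau n)))"
    unfolding fp by (rule finite_imageI[OF finite_dellac])
  show "card (torus_fixed_points n (schubert_variety n (tau n))) = normalized_median_genocchi n"
    unfolding fp normalized_median_genocchi_def by (rule card_image[OF inj_on_dellac_point[OF assms]])
qed

end
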